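(* Let $W$ be an irreducible finite real reflection group of rank $n\le 2$, with Coxeter number $h$. Then for all admissible hsops $\Theta$, the subvariety $V^\Theta\subset V$ consists of $(h+1)^n$ distinct points, and there is a $W\times C$-equivariant bijection between $V^\Theta$ and $\mathsf{Park}^{NC}_W$.
   Context: $W$ acts irreducibly and orthogonally on $V\cong\mathbb{R}^n$; we also write $V$ for the complexification $\mathbb{C}^n$. $T\subset W$ is the set of reflections. Fix simple reflections $s_1,\dots,s_n$ and a Coxeter element $c=s_1\cdots s_n$; $h$ is its order, $C=\langle c\rangle$, $\omega=e^{2\pi i/h}$. Noncrossing parking functions: $\mathcal{L}$ is the set of all intersections (flats) of reflecting hyperplanes of $W$ (including $V$). For $X\in\mathcal{L}$, $W_X$ is the pointwise stabilizer of $X$. Let $\ell_T(w)$ be the least $k$ such that $w$ is a product of $k$ reflections, and write $u\le_T v$ iff $\ell_T(v)=\ell_T(u)+\ell_T(u^{-1}v)$. $NC(W)=\{w\in W:w\le_T c\}$, identified via the injection $w\mapsto V^w$ with a set of flats (noncrossing flats). $\mathsf{Park}^{NC}_W$ is the set of classes $[w,X]$ with $w\in W$, $X\in NC(W)$, where $[w,X]=[w',X']$ iff $X=X'$ and $wW_X=w'W_X$. $W\times C$ acts by $(v,c^d).[w,X]=[vwc^{-d},c^d(X)]$. Hsops: $\mathbb{C}[V]=\mathbb{C}[x_1,\dots,x_n]$ with $x_1,\dots,x_n$ a basis of $V^*$. An admissible hsop is a homogeneous system of parameters $\Theta=(\theta_1,\dots,\theta_n)$ in $\mathbb{C}[V]$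 with all $\theta_i$ of degree $h+1$ such that the linear isomorphism $V^*\to\mathbb{C}\theta_1+\cdots+\mathbb{C}\theta_n$, $x_i\mapsto\theta_i$, is $W$-equivariant. $V^\Theta\subset V=\mathbb{C}^n$ is the zero locus of the ideal $(\theta_1-x_1,\dots,\theta_n-x_n)$; $W$ acts on it by restriction of its linear action on $V$, and $c^d\in C$ acts by scaling by $\omega^d$. *)

theory Defs
  imports
    "HOL-Analysis.Analysis"
    "HOL-Algebra.Coset"
    "HOL-Algebra.Generated_Groups"
    "HOL-Algebra.Multiplicative_Group"
    "HOL-Library.Function_Algebras"
begin

section \<open>Finite real reflection groups\<close>

definition orthogonal_group :: "(real^'n^'n) monoid" where
  "orthogonal_group = \<lparr>carrier = {A. orthogonal_matrix A}, mult = (**), one = mat 1\<rparr>"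

lemma group_orthogonal_group: "group (orthogonal_group :: (real^'n^'n) monoid)"
proof (rule groupI)
  fix A :: "real^'n^'n"
  assume "A \<in> carrier orthogonal_group"
  then show "\<exists>B\<in>carrier orthogonal_group. B \<otimes>\<^bsub>orthogonal_group\<^esub> A = \<one>\<^bsub>orthogonal_group\<^esub>"
    by (intro bexI[of _ "transpose A"])
       (auto simp: orthogonal_group_def orthogonal_matrix_def)
qed (auto simp: orthogonal_group_def orthogonal_matrix_mul orthogonal_matrix_id matrix_mul_assoc)

definition reflection_along :: "real^'n \<Rightarrow> real^'n^'n" where
  "reflection_along a = matrix (\<lambda>x. x - (2 * (x \<bullet> a) / (a \<bullet> a)) *\<^sub>R a)"

definition reflections :: "(real^'n^'n) set \<Rightarrow> (real^'n^'n) set" where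
  "reflections W = {t \<in> W. \<exists>a. a \<noteq> 0 \<and> t = reflection_along a}"

definition acts_irreducibly :: "(real^'n^'n) set \<Rightarrow> bool" where
  "acts_irreducibly W \<longleftrightarrow>
     (\<forall>U. subspace U \<and> (\<forall>w\<in>W. (*v) w ` U \<subseteq> U) \<longrightarrow> U = {0} \<or> U = UNIV)"

definition irreducible_reflection_group :: "(real^'n^'n) set \<Rightarrow> bool" where
  "irreducible_reflection_group W \<longleftrightarrow>
     subgroup W orthogonal_group \<and> finite W \<and>
     generate orthogonal_group (reflections W) = W \<and>
     acts_irreducibly W"

definition unit_roots :: "(real^'n^'n) set \<Rightarrow> (real^'n) set" where
  "unit_roots W = {a. norm a = 1 \<and> reflection_along a \<in> W}"

text \<open>
  The list is a simple system of the (normalised) root system of \<open>W\<close>, in an arbitrary order.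
  It is required to be a basis of the whole space, so its length is the dimension.
\<close>
definition simple_system :: "(real^'n^'n) set \<Rightarrow> (real^'n) list \<Rightarrow> bool" where
  "simple_system W as \<longleftrightarrow>
     distinct as \<and> set as \<subseteq> unit_roots W \<and> independent (set as) \<and> span (set as) = UNIV \<and>
     (\<forall>b\<in>unit_roots W. \<exists>k. b = (\<Sum>a\<in>set as. k a *\<^sub>R a) \<and>
        ((\<forall>a\<in>set as. 0 \<le> k a) \<or> (\<forall>a\<in>set as. k a \<le> 0)))"

definition matrix_prod :: "(real^'n^'n) list \<Rightarrow> real^'n^'n" where
  "matrix_prod ts = foldr (**) ts (mat 1)"

definition coxeter_element :: "(real^'n) list \<Rightarrow> real^'n^'n" where
  "coxeter_element as = matrix_prod (map reflection_along as)"


section \<open>Noncrossing parking functions\<close>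

definition reflection_length :: "(real^'n^'n) set \<Rightarrow> real^'n^'n \<Rightarrow> nat" where
  "reflection_length W w =
     (LEAST k. \<exists>ts. length ts = k \<and> set ts \<subseteq> reflections W \<and> w = matrix_prod ts)"

definition absolute_le :: "(real^'n^'n) set \<Rightarrow> real^'n^'n \<Rightarrow> real^'n^'n \<Rightarrow> bool" where
  "absolute_le W u v \<longleftrightarrow>
     reflection_length W v =
       reflection_length W u + reflection_length W (inv\<^bsub>orthogonal_group\<^esub> u ** v)"

definition fixed_space :: "real^'n^'n \<Rightarrow> (real^'n) set" where
  "fixed_space w = {x. w *v x = x}"

definition noncrossing_flats :: "(real^'n^'n) set \<Rightarrow> real^'n^'n \<Rightarrow> (real^'n) set set" where
  "noncrossing_flats W c = fixed_space ` {w \<in> W. absolute_le W w c}"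

definition pointwise_stabilizer :: "(real^'n^'n) set \<Rightarrow> (real^'n) set \<Rightarrow> (real^'n^'n) set" where
  "pointwise_stabilizer W X = {w \<in> W. \<forall>x\<in>X. w *v x = x}"

definition parking_rel ::
    "(real^'n^'n) set \<Rightarrow> real^'n^'n \<Rightarrow>
     (((real^'n^'n) \<times> (real^'n) set) \<times> ((real^'n^'n) \<times> (real^'n) set)) set" where
  "parking_rel W c =
     {((w, X), (w', X')).
        w \<in> W \<and> X \<in> noncrossing_flats W c \<and> w' \<in> W \<and> X' \<in> noncrossing_flats W c \<and> X = X' \<and>
        w <#\<^bsub>orthogonal_group\<^esub> pointwise_stabilizer W X =
        w' <#\<^bsub>orthogonal_group\<^esub> pointwise_stabilizer W X}"

definition Park_NC ::
    "(real^'n^'n) set \<Rightarrow> real^'n^'n \<Rightarrow> ((real^'n^'n) \<times> (real^'n) set) set set" where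
  "Park_NC W c = (W \<times> noncrossing_flats W c) // parking_rel W c"

text \<open>
  The action of \<open>(v, g)\<close> with \<open>g\<close> a power of \<open>c\<close>, applied to all representatives \<open>(w, X)\<close> of a
  class.  The image of a class is again a full class, because
  \<open>g W\<^sub>X g\<inverse>\<close> is the pointwise stabilizer of \<open>g X\<close>.
\<close>
definition parking_action ::
    "real^'n^'n \<Rightarrow> real^'n^'n \<Rightarrow> ((real^'n^'n) \<times> (real^'n) set) set \<Rightarrow>
     ((real^'n^'n) \<times> (real^'n) set) set" where
  "parking_action v g P = (\<lambda>(w, X). (v ** w ** inv\<^bsub>orthogonal_group\<^esub> g, (*v) g ` X)) ` P"


section \<open>The coordinate ring of the complexification\<close>

text \<open>
  \<open>\<complex>[V]\<close> is represented as the ring of polynomial functions on \<open>V = \<complex>\<^sup>n\<close>, inside the complex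
  vector space of all functions on \<open>V\<close>, with pointwise operations.
\<close>

definition fun_scale :: "complex \<Rightarrow> ('v \<Rightarrow> complex) \<Rightarrow> 'v \<Rightarrow> complex" where
  "fun_scale a f = (\<lambda>z. a * f z)"

interpretation cfun: vector_space fun_scale
  by standard (auto simp: fun_scale_def fun_eq_iff algebra_simps)

definition monomial :: "('n \<Rightarrow> nat) \<Rightarrow> complex^'n \<Rightarrow> complex" where
  "monomial e z = (\<Prod>i\<in>UNIV. (z $ i) ^ e i)"

definition polynomials :: "(complex^'n \<Rightarrow> complex) set" where
  "polynomials = cfun.span (range monomial)"

definition homogeneous_part :: "nat \<Rightarrow> (complex^'n \<Rightarrow> complex) set" where
  "homogeneous_part d = cfun.span {monomial e | e. (\<Sum>i\<in>UNIV. e i) = d}"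

definition dual_space :: "(complex^'n \<Rightarrow> complex) set" where
  "dual_space = {f. Vector_Spaces.linear (*s) (*) f}"

definition is_dual_basis :: "('n \<Rightarrow> complex^'n \<Rightarrow> complex) \<Rightarrow> bool" where
  "is_dual_basis x \<longleftrightarrow>
     inj x \<and> \<not> cfun.dependent (range x) \<and> cfun.span (range x) = dual_space"

definition complexify :: "real^'n^'n \<Rightarrow> complex^'n^'n" where
  "complexify w = (\<chi> i j. complex_of_real (w $ i $ j))"

definition fun_action ::
    "real^'n^'n \<Rightarrow> (complex^'n \<Rightarrow> complex) \<Rightarrow> complex^'n \<Rightarrow> complex" where
  "fun_action w f = (\<lambda>z. f (complexify (inv\<^bsub>orthogonal_group\<^esub> w) *v z))"


section \<open>Homogeneous systems of parameters\<close>

text \<open>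
  Homogeneous elements of positive degree, as many as the Krull dimension, such that \<open>\<complex>[V]\<close> is a
  finitely generated module over \<open>\<complex>[\<theta>\<^sub>1, \<dots>, \<theta>\<^sub>n]\<close>.  The coefficient of a module generator \<open>b\<close> is
  \<open>q b\<close> evaluated at \<open>(\<theta>\<^sub>1, \<dots>, \<theta>\<^sub>n)\<close>.
\<close>
definition is_hsop :: "('n \<Rightarrow> complex^'n \<Rightarrow> complex) \<Rightarrow> bool" where
  "is_hsop \<theta> \<longleftrightarrow>
     (\<forall>i. \<exists>d>0. \<theta> i \<in> homogeneous_part d) \<and>
     (\<exists>B. finite B \<and> B \<subseteq> polynomials \<and>
        (\<forall>f\<in>polynomials. \<exists>q. (\<forall>b\<in>B. q b \<in> polynomials) \<and>
           f = (\<lambda>z. \<Sum>b\<in>B. q b (\<chi> i. \<theta> i z) * b z)))"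

text \<open>
  The isomorphism is given by a linear map \<open>\<phi>\<close> on the space of all functions, of which only the
  restriction to the dual space matters; every linear map on a subspace extends.
\<close>
definition admissible_hsop ::
    "(real^'n^'n) set \<Rightarrow> nat \<Rightarrow> ('n \<Rightarrow> complex^'n \<Rightarrow> complex) \<Rightarrow>
     ('n \<Rightarrow> complex^'n \<Rightarrow> complex) \<Rightarrow> bool" where
  "admissible_hsop W h x \<theta> \<longleftrightarrow>
     is_hsop \<theta> \<and> (\<forall>i. \<theta> i \<in> homogeneous_part (h + 1)) \<and>
     (\<exists>\<phi>. Vector_Spaces.linear fun_scale fun_scale \<phi> \<and> (\<forall>i. \<phi> (x i) = \<theta> i) \<and>
        bij_betw \<phi> dual_space (cfun.span (range \<theta>)) \<and>
        (\<forall>w\<in>W. \<forall>f\<in>dual_space. \<phi> (fun_action w f) = fun_action w (\<phi> f)))"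

definition poly_ideal :: "('n \<Rightarrow> complex^'n \<Rightarrow> complex) \<Rightarrow> (complex^'n \<Rightarrow> complex) set" where
  "poly_ideal p = {(\<Sum>i\<in>UNIV. g i * p i) | g. \<forall>i. g i \<in> polynomials}"

definition zero_locus :: "(complex^'n \<Rightarrow> complex) set \<Rightarrow> (complex^'n) set" where
  "zero_locus I = {z. \<forall>f\<in>I. f z = 0}"

definition V_Theta ::
    "('n \<Rightarrow> complex^'n \<Rightarrow> complex) \<Rightarrow> ('n \<Rightarrow> complex^'n \<Rightarrow> complex) \<Rightarrow> (complex^'n) set" where
  "V_Theta x \<theta> = zero_locus (poly_ideal (\<lambda>i. \<theta> i - x i))"

text \<open>The action of \<open>(v, c\<^sup>d)\<close>, where \<open>h\<close> is the order of \<open>c\<close>.\<close>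
definition V_action :: "nat \<Rightarrow> real^'n^'n \<Rightarrow> nat \<Rightarrow> complex^'n \<Rightarrow> complex^'n" where
  "V_action h v d z = (cis (2 * pi / real h)) ^ d *s (complexify v *v z)"

text \<open>
  Since \<open>c\<close> has finite order, the elements of \<open>W \<times> \<langle>c\<rangle>\<close> are the pairs \<open>(v, c\<^sup>d)\<close> with \<open>d\<close> a
  natural number.  That \<open>V_action\<close> preserves \<open>Z\<close> is part of the definition.
\<close>
definition equivariant_bijection ::
    "(real^'n^'n) set \<Rightarrow> real^'n^'n \<Rightarrow> nat \<Rightarrow> (complex^'n) set \<Rightarrow>
     (complex^'n \<Rightarrow> ((real^'n^'n) \<times> (real^'n) set) set) \<Rightarrow> bool" where
  "equivariant_bijection W c h Z F \<longleftrightarrow>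
     bij_betw F Z (Park_NC W c) \<and>
     (\<forall>v\<in>W. \<forall>d. \<forall>z\<in>Z.
        V_action h v d z \<in> Z \<and>
        F (V_action h v d z) = parking_action v (c [^]\<^bsub>orthogonal_group\<^esub> d) (F z))"

end

theory Submission
  imports Defs "HOL-Computational_Algebra.Fundamental_Theorem_Algebra"
begin

text \<open>
  A \<open>W \<times> C\<close>-equivariant bijection is obtained by choosing for each noncrossing flat \<open>X\<close> a point
  \<open>q\<^sub>X\<close> of \<open>V\<^sup>\<Theta>\<close> whose stabilizer in \<open>W\<close> is \<open>W\<^sub>X\<close>, in such a way that
  \<open>q\<^bsub>c X\<^esub> = \<omega> c q\<^sub>X\<close>, and sending \<open>[w, X]\<close> to \<open>w q\<^sub>X\<close>.

  In rank two, \<open>W\<close> is dihedral of order \<open>2 m\<close> with \<open>m = h\<close>.  In coordinates \<open>u, v\<close> that are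
  eigenvectors of \<open>c\<close>, the system \<open>\<Theta>\<close> is
  \<open>\<alpha> u\<^bsup>m+1\<^esup> + \<beta> u\<^bsup>m/2+1\<^esup> v\<^bsup>m/2\<^esup> + \<gamma> u v\<^bsup>m\<^esup>\<close> together with its image under \<open>u \<leftrightarrow> v\<close>, where \<open>\<beta> = 0\<close>
  for odd \<open>m\<close>.  Since \<open>\<Theta>\<close> has no nontrivial common zero, \<open>\<alpha> \<noteq> 0\<close>, \<open>\<alpha> \<noteq> \<gamma>\<close> and
  \<open>D \<zeta> = \<alpha> + \<beta> \<zeta>\<^bsup>m/2\<^esup> + \<gamma> \<noteq> 0\<close> for all \<open>m\<close>-th roots of unity \<open>\<zeta>\<close>.  Hence \<open>V\<^sup>\<Theta>\<close> consists of
  the origin, \<open>m\<close> points on each coordinate axis, and \<open>m\<close> points \<open>(a, a \<zeta>)\<close> with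
  \<open>a\<^bsup>m\<^esup> D \<zeta> = 1\<close> for each \<open>\<zeta>\<close>, the latter on the complexifications of the \<open>m\<close> mirrors.
  These three kinds of points correspond to the flats \<open>{0}\<close>, \<open>V\<close> and the mirrors.
\<close>

section \<open>Elementary facts on the orthogonal group\<close>

lemma orthogonal_group_simps [simp]:
  "carrier orthogonal_group = {A. orthogonal_matrix A}"
  "A \<otimes>\<^bsub>orthogonal_group\<^esub> B = A ** B"
  "\<one>\<^bsub>orthogonal_group\<^esub> = mat 1"
  by (auto simp: orthogonal_group_def)

lemma inv_orthogonal_group:
  "orthogonal_matrix A \<Longrightarrow> inv\<^bsub>orthogonal_group\<^esub> A = transpose A"
  by (rule group.inv_equality[OF group_orthogonal_group])
     (auto simp: orthogonal_matrix_def)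

lemma subgroup_orthogonal_groupD:
  assumes "subgroup W orthogonal_group"
  shows "A \<in> W \<Longrightarrow> orthogonal_matrix A"
    and "A \<in> W \<Longrightarrow> B \<in> W \<Longrightarrow> A ** B \<in> W"
    and "mat 1 \<in> W"
    and "A \<in> W \<Longrightarrow> transpose A \<in> W"
proof -
  show orth: "orthogonal_matrix A" if "A \<in> W" for A
    using subgroup.mem_carrier[OF assms that] by simp
  show "A ** B \<in> W" if "A \<in> W" "B \<in> W" for A B
    using subgroup.m_closed[OF assms that] by simp
  show "mat 1 \<in> W"
    using subgroup.one_closed[OF assms] by simp
  show "transpose A \<in> W" if "A \<in> W"
    using subgroup.m_inv_closed[OF assms that] orth[OF that] inv_orthogonal_group by metis
qed

lemma left_coset_eq_iff:
  assumes H: "subgroup H orthogonal_group" and "orthogonal_matrix A" "orthogonal_matrix B"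
  shows "A <#\<^bsub>orthogonal_group\<^esub> H = B <#\<^bsub>orthogonal_group\<^esub> H \<longleftrightarrow> transpose B ** A \<in> H"
proof -
  have "A <#\<^bsub>orthogonal_group\<^esub> H = B <#\<^bsub>orthogonal_group\<^esub> H \<longleftrightarrow>
      A \<in> B <#\<^bsub>orthogonal_group\<^esub> H"
  proof
    have "A \<in> A <#\<^bsub>orthogonal_group\<^esub> H"
      using subgroup.one_closed[OF H] by (force simp: l_coset_def)
    then show "A \<in> B <#\<^bsub>orthogonal_group\<^esub> H"
      if "A <#\<^bsub>orthogonal_group\<^esub> H = B <#\<^bsub>orthogonal_group\<^esub> H"
      using that by simp
    show "A <#\<^bsub>orthogonal_group\<^esub> H = B <#\<^bsub>orthogonal_group\<^esub> H"
      if "A \<in> B <#\<^bsub>orthogonal_group\<^esub> H"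
      using group.l_repr_independence[OF group_orthogonal_group that _ H] assms(3) by simp
  qed
  also have "\<dots> \<longleftrightarrow> (\<exists>h\<in>H. A = B ** h)"
    by (auto simp: l_coset_def)
  also have "\<dots> \<longleftrightarrow> transpose B ** A \<in> H"
    using assms(3) by (metis matrix_mul_assoc matrix_mul_lid orthogonal_matrix_def)
  finally show ?thesis .
qed

lemma subgroup_pointwise_stabilizer:
  assumes "subgroup W orthogonal_group"
  shows "subgroup (pointwise_stabilizer W X) orthogonal_group"
proof (rule group.subgroupI[OF group_orthogonal_group])
  note W = subgroup_orthogonal_groupD[OF assms]
  show "pointwise_stabilizer W X \<subseteq> carrier orthogonal_group"
    using W by (auto simp: pointwise_stabilizer_def)
  show "pointwise_stabilizer W X \<noteq> {}"
    using W(3) by (auto simp: pointwise_stabilizer_def)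
  fix a b
  assume a: "a \<in> pointwise_stabilizer W X" and b: "b \<in> pointwise_stabilizer W X"
  show "a \<otimes>\<^bsub>orthogonal_group\<^esub> b \<in> pointwise_stabilizer W X"
    using a b W(2) by (auto simp: pointwise_stabilizer_def simp flip: matrix_vector_mul_assoc)
  have "transpose a *v x = x" if "x \<in> X" for x
  proof -
    have "transpose a *v (a *v x) = x"
      using W(1) a by (auto simp: matrix_vector_mul_assoc orthogonal_matrix_def pointwise_stabilizer_def)
    then show ?thesis
      using a that by (auto simp: pointwise_stabilizer_def)
  qed
  then show "inv\<^bsub>orthogonal_group\<^esub> a \<in> pointwise_stabilizer W X"
    using a W(1,4) by (auto simp: pointwise_stabilizer_def inv_orthogonal_group)
qed

lemma complexify_mul: "complexify (A ** B) = complexify A ** complexify B"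
  by (simp add: complexify_def matrix_matrix_mult_def vec_eq_iff)

lemma complexify_mat_1: "complexify (mat 1) = mat 1"
  by (simp add: complexify_def mat_def vec_eq_iff)

lemma orthogonal_matrix_transpose_mul:
  "orthogonal_matrix A \<Longrightarrow> transpose A ** A = mat 1"
  "orthogonal_matrix A \<Longrightarrow> A ** transpose A = mat 1"
  by (auto simp: orthogonal_matrix_def)

section \<open>Equivariant bijections from base points of the flats\<close>

text \<open>
  Under the hypotheses, \<open>[w, X] \<mapsto> w q\<^sub>X\<close> is a well-defined bijection, whose inverse sends
  a point to its fibre under \<open>(w, X) \<mapsto> w q\<^sub>X\<close>.
\<close>
lemma equivariant_bijection_from_base_points:
  fixes W :: "(real^'n^'n) set" and q :: "(real^'n) set \<Rightarrow> complex^'n"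
  assumes W: "subgroup W orthogonal_group" and c: "c \<in> W"
    and flats: "\<And>X. X \<in> noncrossing_flats W c \<Longrightarrow> (*v) c ` X \<in> noncrossing_flats W c"
      "\<And>X. X \<in> noncrossing_flats W c \<Longrightarrow> (*v) (transpose c) ` X \<in> noncrossing_flats W c"
    and q_c: "\<And>X. X \<in> noncrossing_flats W c \<Longrightarrow> q ((*v) c ` X) = V_action h c 1 (q X)"
    and q_eq: "\<And>w X X'. w \<in> W \<Longrightarrow> X \<in> noncrossing_flats W c \<Longrightarrow> X' \<in> noncrossing_flats W c \<Longrightarrow>
       complexify w *v q X = q X' \<longleftrightarrow> X = X' \<and> w \<in> pointwise_stabilizer W X"
    and Z: "Z = {complexify w *v q X | w X. w \<in> W \<and> X \<in> noncrossing_flats W c}"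
  shows "\<exists>F. equivariant_bijection W c h Z F"
proof -
  define NC where "NC = noncrossing_flats W c"
  define p where "p = (\<lambda>(w, X). complexify w *v q X)"
  define F where "F z = {a \<in> W \<times> NC. p a = z}" for z
  note WD = subgroup_orthogonal_groupD[OF W]
  have Z': "Z = p ` (W \<times> NC)"
    unfolding Z p_def NC_def by auto
  \<comment> \<open>The relation is the kernel of \<open>p\<close>, so its classes are the fibres
    \<open>F z\<close> and the bijectivity of \<open>F\<close> comes for free.\<close>
  have rel: "parking_rel W c = {(a, b). a \<in> W \<times> NC \<and> b \<in> W \<times> NC \<and> p a = p b}"
  proof -
    have "(X = X' \<and> w <#\<^bsub>orthogonal_group\<^esub> pointwise_stabilizer W X =
             w' <#\<^bsub>orthogonal_group\<^esub> pointwise_stabilizer W X)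
        \<longleftrightarrow> complexify w *v q X = complexify w' *v q X'"
      if "w \<in> W" "w' \<in> W" "X \<in> NC" "X' \<in> NC" for w w' X X'
    proof -
      have "complexify w *v q X = complexify w' *v q X' \<longleftrightarrow>
          complexify (transpose w' ** w) *v q X = q X'"
        using orthogonal_matrix_transpose_mul[OF WD(1)[OF that(2)]]
        by (metis complexify_mat_1 complexify_mul matrix_vector_mul_assoc matrix_vector_mul_lid)
      also have "\<dots> \<longleftrightarrow> X = X' \<and> transpose w' ** w \<in> pointwise_stabilizer W X"
        using that WD(2,4) unfolding NC_def by (intro q_eq) auto
      finally show ?thesis
        using left_coset_eq_iff[OF subgroup_pointwise_stabilizer[OF W] WD(1) WD(1)] that by blast
    qed
    note iff = this
    show ?thesis
    proof (rule Set.set_eqI)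
      fix a
      obtain w w' :: "real^'n^'n" and X X' :: "(real^'n) set" where a: "a = ((w, X), (w', X'))"
        by (metis surj_pair)
      show "a \<in> parking_rel W c \<longleftrightarrow>
          a \<in> {(a, b). a \<in> W \<times> NC \<and> b \<in> W \<times> NC \<and> p a = p b}"
        unfolding a parking_rel_def NC_def[symmetric] using iff[of w w' X X'] by (auto simp: p_def)
    qed
  qed
  have "Park_NC W c = F ` Z"
  proof -
    have "parking_rel W c `` {a} = F (p a)" if "a \<in> W \<times> NC" for a
      using that unfolding rel F_def by auto
    then have "(\<lambda>a. parking_rel W c `` {a}) ` (W \<times> NC) = (F \<circ> p) ` (W \<times> NC)"
      by (intro image_cong) auto
    moreover have "Park_NC W c = (\<lambda>a. parking_rel W c `` {a}) ` (W \<times> NC)"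
      unfolding Park_NC_def quotient_def NC_def by blast
    ultimately show ?thesis
      by (simp add: Z' image_comp)
  qed
  moreover have "inj_on F Z"
    unfolding inj_on_def Z' F_def by blast
  ultimately have bij: "bij_betw F Z (Park_NC W c)"
    by (simp add: bij_betw_def)
  define g where "g d = c [^]\<^bsub>orthogonal_group\<^esub> d" for d :: nat
  have g_Suc: "g (Suc d) = g d ** c" and g_0: "g 0 = mat 1" for d
    using group.is_monoid[OF group_orthogonal_group] by (auto simp: g_def monoid.nat_pow_Suc)
  have g_W: "g d \<in> W" for d
    by (induction d) (auto simp: g_Suc g_0 WD c)
  have g_NC: "(*v) (g d) ` X \<in> NC" if "X \<in> NC" for d X
    using that
  proof (induction d arbitrary: X)
    case (Suc d)
    then have "(*v) (g d) ` (*v) c ` X \<in> NC"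
      using flats NC_def by blast
    then show ?case
      by (simp add: g_Suc image_image matrix_vector_mul_assoc)
  qed (auto simp: g_0)
  \<comment> \<open>Needed to pull a representative of the acted-on class back by the inverse of
    \<open>g d\<close>, which shows that the image of a class is a full class.\<close>
  have g'_NC: "(*v) (transpose (g d)) ` X \<in> NC" if "X \<in> NC" for d X
    using that
  proof (induction d arbitrary: X)
    case (Suc d)
    then have "(*v) (transpose c) ` (*v) (transpose (g d)) ` X \<in> NC"
      using flats NC_def by blast
    then show ?case
      by (simp add: g_Suc image_image matrix_vector_mul_assoc matrix_transpose_mul
          del: transpose_matrix_vector)
  qed (auto simp: g_0 transpose_mat)
  have V_action_add: "V_action h (g d) d (V_action h c 1 z) = V_action h (g (Suc d)) (Suc d) z" for d z
    by (simp add: V_action_def g_Suc complexify_mul vector_scalar_commute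
        matrix_vector_mul_assoc mult.commute)
  have q_g: "q ((*v) (g d) ` X) = V_action h (g d) d (q X)" if "X \<in> NC" for d X
    using that
  proof (induction d arbitrary: X)
    case 0
    then show ?case by (simp add: g_0 V_action_def complexify_mat_1)
  next
    case (Suc d)
    then have "q ((*v) (g d) ` (*v) c ` X) = V_action h (g (Suc d)) (Suc d) (q X)"
      using flats q_c V_action_add unfolding NC_def by metis
    then show ?case
      by (simp add: g_Suc image_image matrix_vector_mul_assoc)
  qed
  \<comment> \<open>The factor \<open>transpose (g d)\<close> cancels the \<open>g d\<close>
    produced by \<open>q_g\<close>, so that only \<open>v\<close> and the scalar remain.\<close>
  have p_act: "p (v ** w ** transpose (g d), (*v) (g d) ` X) = V_action h v d (p (w, X))"
    if "v \<in> W" "w \<in> W" "X \<in> NC" for v w d X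
  proof -
    have "complexify (transpose (g d)) *v (complexify (g d) *v q X) = q X"
      using orthogonal_matrix_transpose_mul(1)[OF WD(1)[OF g_W]]
      by (metis complexify_mat_1 complexify_mul matrix_vector_mul_assoc matrix_vector_mul_lid)
    then show ?thesis
      by (simp add: p_def q_g[OF that(3)] V_action_def complexify_mul vector_scalar_commute
          flip: matrix_vector_mul_assoc)
  qed
  have equi: "V_action h v d z \<in> Z \<and> F (V_action h v d z) = parking_action v (g d) (F z)"
    if v: "v \<in> W" and z: "z \<in> Z" for v d z
  proof
    have inv: "inv\<^bsub>orthogonal_group\<^esub> g d = transpose (g d)"
      using inv_orthogonal_group WD(1) g_W by blast
    from z obtain w X where "w \<in> W" "X \<in> NC" "z = p (w, X)"
      unfolding Z' by auto
    then show "V_action h v d z \<in> Z"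
      using p_act[OF v, of w X d, symmetric] WD(2,4) v g_W g_NC[of X d] unfolding Z'
      by (intro image_eqI[of _ _ "(v ** w ** transpose (g d), (*v) (g d) ` X)"]) auto
    show "F (V_action h v d z) = parking_action v (g d) (F z)"
    proof (intro equalityI subsetI)
      fix a assume "a \<in> parking_action v (g d) (F z)"
      then obtain w X where "w \<in> W" "X \<in> NC" "z = p (w, X)"
          "a = (v ** w ** transpose (g d), (*v) (g d) ` X)"
        unfolding parking_action_def inv F_def by auto
      then show "a \<in> F (V_action h v d z)"
        using p_act[OF v, of w X d] WD(2,4) v g_W g_NC unfolding F_def by auto
    next
      fix a assume "a \<in> F (V_action h v d z)"
      then obtain w X where a: "a = (w, X)" "w \<in> W" "X \<in> NC" "p (w, X) = V_action h v d z"
        unfolding F_def by auto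
      \<comment> \<open>The pair \<open>(w', X')\<close> undoes the action of \<open>v\<close> and
        \<open>g d\<close> on \<open>(w, X)\<close>.\<close>
      define w' where "w' = transpose v ** w ** g d"
      define X' where "X' = (*v) (transpose (g d)) ` X"
      have w': "w' \<in> W" "X' \<in> NC"
        using a WD(2,4) v g_W g'_NC[OF a(3), of d] unfolding w'_def X'_def by auto
      have w_eq: "v ** w' ** transpose (g d) = w"
      proof -
        have "v ** w' ** transpose (g d) = (v ** transpose v) ** w ** (g d ** transpose (g d))"
          by (simp add: w'_def matrix_mul_assoc)
        then show ?thesis
          by (simp add: orthogonal_matrix_transpose_mul WD(1) v g_W)
      qed
      have X_eq: "(*v) (g d) ` X' = X"
        unfolding X'_def using orthogonal_matrix_transpose_mul(2)[OF WD(1)[OF g_W]]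
        by (simp add: image_image matrix_vector_mul_assoc del: transpose_matrix_vector)
      have "V_action h v d (p (w', X')) = V_action h v d z"
        using p_act[OF v w', of d] a w_eq X_eq by simp
      then have "complexify v *v p (w', X') = complexify v *v z"
        by (simp add: V_action_def)
      then have "p (w', X') = z"
        using orthogonal_matrix_transpose_mul(1)[OF WD(1)[OF v]]
        by (metis complexify_mat_1 complexify_mul matrix_vector_mul_assoc matrix_vector_mul_lid)
      then show "a \<in> parking_action v (g d) (F z)"
        unfolding parking_action_def inv F_def using w' w_eq X_eq a(1) by force
    qed
  qed
  show ?thesis
    unfolding equivariant_bijection_def using bij equi g_def by auto
qed

section \<open>Zero loci of admissible systems of parameters\<close>

lemma constant_polynomial: "(\<lambda>z. k) \<in> polynomials"
proof -
  have "fun_scale k (monomial (\<lambda>_. 0)) \<in> polynomials"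
    unfolding polynomials_def by (intro cfun.span_scale cfun.span_base) simp
  then show ?thesis by (simp add: fun_scale_def monomial_def)
qed

lemma sum_fun_apply: "(\<Sum>i\<in>A. f i) z = (\<Sum>i\<in>A. f i z)"
  by (induction A rule: infinite_finite_induct) auto

text \<open>The constants 0 and 1 are admissible coefficients, so every single generator lies in the
  ideal.\<close>

lemma V_Theta_eq: "V_Theta x \<theta> = {z. \<forall>i. \<theta> i z = x i z}"
proof (intro equalityI subsetI)
  fix z assume "z \<in> {z. \<forall>i. \<theta> i z = x i z}"
  then show "z \<in> V_Theta x \<theta>"
    by (auto simp: V_Theta_def zero_locus_def poly_ideal_def sum_fun_apply)
next
  fix z assume z: "z \<in> V_Theta x \<theta>"
  have "\<theta> k z = x k z" for k
  proof -
    define g :: "'a \<Rightarrow> complex^'a \<Rightarrow> complex" where "g i = (\<lambda>z. if i = k then 1 else 0)" for i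
    have "(\<Sum>i\<in>UNIV. g i * (\<theta> i - x i)) \<in> poly_ideal (\<lambda>i. \<theta> i - x i)"
      unfolding poly_ideal_def using constant_polynomial by (auto simp: g_def intro!: exI[of _ g])
    then have "(\<Sum>i\<in>UNIV. g i * (\<theta> i - x i)) z = 0"
      using z unfolding V_Theta_def zero_locus_def by blast
    then have "(\<Sum>i\<in>UNIV. (if i = k then \<theta> i z - x i z else 0)) = 0"
      by (simp add: sum_fun_apply g_def if_distrib[of "\<lambda>t. t * _"] cong: if_cong)
    then show ?thesis by simp
  qed
  then show "z \<in> {z. \<forall>i. \<theta> i z = x i z}" by simp
qed

lemma homogeneous_part_scale:
  assumes "f \<in> homogeneous_part d"
  shows "f (s *s z) = s ^ d * f z"
  using assms unfolding homogeneous_part_def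
proof (induction rule: cfun.span_induct_alt)
  case (step k m f)
  then show ?case
    by (auto simp: monomial_def fun_scale_def power_mult_distrib prod.distrib power_sum algebra_simps)
qed auto

lemma polynomial_on_line:
  assumes "f \<in> polynomials"
  shows "\<exists>p :: complex poly. \<forall>s. f (s *s z) = poly p s"
  using assms unfolding polynomials_def
proof (induction rule: cfun.span_induct_alt)
  case base
  show ?case by (intro exI[of _ 0]) simp
next
  case (step k m f)
  then obtain e p where "m = monomial e" "\<forall>s. f (s *s z) = poly p s" by auto
  then show ?case
    by (intro exI[of _ "Polynomial.smult k (Polynomial.smult (monomial e z)
          (Polynomial.monom 1 (\<Sum>i\<in>UNIV. e i))) + p"])
       (auto simp: monomial_def fun_scale_def power_mult_distrib prod.distrib power_sum
          Polynomial.poly_monom algebra_simps)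
qed

text \<open>
  If \<open>\<theta>\<close> vanished on a line, then all polynomials restricted to that line would have bounded degree.
\<close>
lemma hsop_common_zero:
  fixes \<theta> :: "'n \<Rightarrow> complex^'n \<Rightarrow> complex"
  assumes hsop: "is_hsop \<theta>" and zero: "\<And>i. \<theta> i z = 0"
  shows "z = 0"
proof (rule ccontr)
  assume "z \<noteq> 0"
  then obtain k where k: "z $ k \<noteq> 0" by (auto simp: vec_eq_iff)
  from hsop obtain B where B: "finite B" "B \<subseteq> polynomials"
    "\<And>f. f \<in> polynomials \<Longrightarrow> \<exists>q. (\<forall>b\<in>B. q b \<in> polynomials) \<and>
           f = (\<lambda>z. \<Sum>b\<in>B. q b (\<chi> i. \<theta> i z) * b z)"
    unfolding is_hsop_def by blast
  have zero': "\<theta> i (s *s z) = 0" for i s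
  proof -
    obtain d where "\<theta> i \<in> homogeneous_part d"
      using hsop unfolding is_hsop_def by blast
    from homogeneous_part_scale[OF this, of s z] show ?thesis
      by (simp add: zero)
  qed
  have "\<forall>b\<in>B. \<exists>p. \<forall>s. b (s *s z) = poly p s"
    using polynomial_on_line B(2) by blast
  then obtain p where p: "\<And>b s. b \<in> B \<Longrightarrow> b (s *s z) = poly (p b) s"
    by metis
  \<comment> \<open>Exceeds the degree of every module generator on the line through
    \<open>z\<close>, so the \<open>N\<close>-th power of a coordinate that is nonzero on it cannot
    be a combination of them with constant coefficients.\<close>
  define N where "N = Suc (\<Sum>b\<in>B. Polynomial.degree (p b))"
  define e where "e i = (if i = k then N else 0)" for i
  have "monomial e \<in> polynomials"
    unfolding polynomials_def by (intro cfun.span_base) simp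
  from B(3)[OF this] obtain q where
    q: "monomial e = (\<lambda>z. \<Sum>b\<in>B. q b (\<chi> i. \<theta> i z) * b z)" by blast
  \<comment> \<open>All \<open>\<theta> i\<close> vanish along the line, so a coefficient
    \<open>q b\<close> enters only through its value at 0.\<close>
  define r where "r = (\<Sum>b\<in>B. Polynomial.smult (q b 0) (p b))"
  have "poly (Polynomial.monom ((z $ k) ^ N) N) s = poly r s" for s
  proof -
    have "(\<chi> i. \<theta> i (s *s z)) = 0"
      by (simp add: zero' vec_eq_iff)
    then have "monomial e (s *s z) = poly r s"
      unfolding q r_def by (simp add: poly_sum p)
    moreover have "monomial e (s *s z) = (s * z $ k) ^ N"
      by (simp add: monomial_def e_def if_distrib[of "\<lambda>n. _ ^ n"] cong: if_cong)
    ultimately show ?thesis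
      by (simp add: Polynomial.poly_monom power_mult_distrib mult.commute)
  qed
  then have "Polynomial.monom ((z $ k) ^ N) N = r"
    by (simp add: poly_eq_poly_eq_iff[symmetric] fun_eq_iff)
  moreover have "Polynomial.degree r < N"
  proof -
    have "Polynomial.degree (Polynomial.smult (q b 0) (p b)) \<le> N - 1" if "b \<in> B" for b
      using member_le_sum[of b B "\<lambda>b. Polynomial.degree (p b)"] that B(1)
        Polynomial.degree_smult_le[of "q b 0" "p b"] unfolding N_def by simp
    then have "Polynomial.degree r \<le> N - 1"
      unfolding r_def by (intro Polynomial.degree_sum_le B(1)) auto
    then show ?thesis by (simp add: N_def)
  qed
  ultimately show False
    using k Polynomial.degree_monom_eq[of "(z $ k) ^ N" N] by simp
qed

section \<open>Admissibility in terms of an arbitrary spanning set of the dual space\<close>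

lemma dual_space_iff:
  fixes f :: "complex^'n \<Rightarrow> complex"
  shows "f \<in> dual_space \<longleftrightarrow> (\<exists>a. f = (\<lambda>z. \<Sum>i\<in>UNIV. a i * z $ i))"
proof
  assume "f \<in> dual_space"
  then interpret Vector_Spaces.linear "(*s)" "(*)" f
    by (simp add: dual_space_def)
  have "f z = (\<Sum>i\<in>UNIV. f (axis i 1) * z $ i)" for z
    using basis_expansion[of z] by (metis (no_types, lifting) mult.commute scale sum sum.cong)
  then have "f = (\<lambda>z. \<Sum>i\<in>UNIV. f (axis i 1) * z $ i)"
    by (rule ext)
  then show "\<exists>a. f = (\<lambda>z. \<Sum>i\<in>UNIV. a i * z $ i)"
    by (rule exI[of _ "\<lambda>i. f (axis i 1)"])
next
  assume "\<exists>a. f = (\<lambda>z. \<Sum>i\<in>UNIV. a i * z $ i)"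
  then show "f \<in> dual_space"
    unfolding dual_space_def
    by (auto simp: algebra_simps sum.distrib sum_distrib_left) (unfold_locales; simp add: algebra_simps sum.distrib sum_distrib_left)
qed

text \<open>The factor \<open>k\<close> serves two purposes: \<open>k = 0\<close> transfers common
  zeros between spanning sets, \<open>k = 1\<close> transfers fixed points.\<close>

lemma linear_eq_on_span:
  assumes "Vector_Spaces.linear fun_scale fun_scale \<phi>" "\<And>b. b \<in> B \<Longrightarrow> \<phi> b z = k * b z"
    and "f \<in> cfun.span B"
  shows "\<phi> f z = (k :: complex) * f z"
proof -
  interpret Vector_Spaces.linear fun_scale fun_scale \<phi> by fact
  show ?thesis
    using assms(3)
  proof (induction rule: cfun.span_induct_alt)
    case base
    show ?case by (simp only: zero) simp
  next
    case (step c b g)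
    then show ?case
      by (simp only: add scale) (simp add: fun_scale_def assms(2) algebra_simps)
  qed
qed

text \<open>Removes the given basis \<open>x\<close>: any spanning set \<open>B\<close> of the dual
  space may replace it, in particular one consisting of eigenvectors of the Coxeter element.
  Linearity of \<open>\<phi>\<close> is recorded pointwise, in the form in which it is
  applied.\<close>

lemma admissible_hsopE:
  fixes x \<theta> :: "'n \<Rightarrow> complex^'n \<Rightarrow> complex"
  assumes "is_dual_basis x" "admissible_hsop W h x \<theta>"
    and B: "cfun.span B = dual_space"
  obtains \<phi> where "\<And>f. f \<in> dual_space \<Longrightarrow> \<phi> f \<in> homogeneous_part (h + 1)"
    and "\<And>w f. w \<in> W \<Longrightarrow> f \<in> dual_space \<Longrightarrow> \<phi> (fun_action w f) = fun_action w (\<phi> f)"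
    and "\<And>z. (\<And>f. f \<in> B \<Longrightarrow> \<phi> f z = 0) \<Longrightarrow> z = 0"
    and "V_Theta x \<theta> = {z. \<forall>f\<in>B. \<phi> f z = f z}"
    and "\<And>f g a b. \<phi> (\<lambda>z. a * f z + b * g z) = (\<lambda>z. a * \<phi> f z + b * \<phi> g z)"
proof -
  from assms(2) obtain \<phi> where hsop: "is_hsop \<theta>"
    and hom: "\<And>i. \<theta> i \<in> homogeneous_part (h + 1)"
    and lin: "Vector_Spaces.linear fun_scale fun_scale \<phi>"
    and \<phi>x: "\<And>i. \<phi> (x i) = \<theta> i"
    and bij: "bij_betw \<phi> dual_space (cfun.span (range \<theta>))"
    and eq: "\<And>w f. w \<in> W \<Longrightarrow> f \<in> dual_space \<Longrightarrow> \<phi> (fun_action w f) = fun_action w (\<phi> f)"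
    unfolding admissible_hsop_def by auto
  have span_x: "cfun.span (range x) = dual_space"
    using assms(1) by (simp add: is_dual_basis_def)
  interpret Vector_Spaces.linear fun_scale fun_scale \<phi> by fact
  show ?thesis
  proof
    show "\<phi> f \<in> homogeneous_part (h + 1)" if "f \<in> dual_space" for f
    proof -
      have "\<phi> f \<in> cfun.span (range \<theta>)"
        using bij that by (auto simp: bij_betw_def)
      also have "\<dots> \<subseteq> homogeneous_part (h + 1)"
        using hom unfolding homogeneous_part_def by (intro cfun.span_minimal) auto
      finally show ?thesis .
    qed
    show "z = 0" if "\<And>f. f \<in> B \<Longrightarrow> \<phi> f z = 0" for z
    proof (rule hsop_common_zero[OF hsop])
      fix i
      have "x i \<in> cfun.span B"
        unfolding B span_x[symmetric] by (rule cfun.span_base) simp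
      then show "\<theta> i z = 0"
        using linear_eq_on_span[OF lin, of B z 0 "x i"] that \<phi>x by simp
    qed
    show "V_Theta x \<theta> = {z. \<forall>f\<in>B. \<phi> f z = f z}"
    proof (intro equalityI subsetI)
      fix z assume "z \<in> V_Theta x \<theta>"
      then have "\<phi> f z = 1 * f z" if "f \<in> range x" for f
        using that \<phi>x by (auto simp: V_Theta_eq)
      from linear_eq_on_span[OF lin this] have "\<phi> f z = f z" if "f \<in> cfun.span B" for f
        using that unfolding B span_x[symmetric] by simp
      then show "z \<in> {z. \<forall>f\<in>B. \<phi> f z = f z}"
        by (simp add: cfun.span_base)
    next
      fix z assume "z \<in> {z. \<forall>f\<in>B. \<phi> f z = f z}"
      then have "\<phi> f z = 1 * f z" if "f \<in> B" for f
        using that by auto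
      from linear_eq_on_span[OF lin this] have "\<phi> f z = f z" if "f \<in> cfun.span (range x)" for f
        using that unfolding B[symmetric] span_x by simp
      then have "\<phi> (x i) z = x i z" for i
        by (simp add: cfun.span_base)
      then show "z \<in> V_Theta x \<theta>"
        by (simp add: V_Theta_eq \<phi>x)
    qed
    fix f g a b
    have "\<phi> (fun_scale a f + fun_scale b g) = fun_scale a (\<phi> f) + fun_scale b (\<phi> g)"
      by (simp add: add scale)
    moreover have "fun_scale a f + fun_scale b g = (\<lambda>z. a * f z + b * g z)" for f g :: "complex^'n \<Rightarrow> complex"
      by (auto simp: fun_scale_def)
    ultimately show "\<phi> (\<lambda>z. a * f z + b * g z) = (\<lambda>z. a * \<phi> f z + b * \<phi> g z)"
      by metis
  qed (fact eq)
qed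

section \<open>Reflections\<close>

lemma matrix_prod_simps [simp]:
  "matrix_prod [] = mat 1" "matrix_prod (t # ts) = t ** matrix_prod ts"
  by (auto simp: matrix_prod_def)

lemma reflection_length_le:
  "set ts \<subseteq> reflections W \<Longrightarrow> reflection_length W (matrix_prod ts) \<le> length ts"
  unfolding reflection_length_def by (rule Least_le) blast

lemma reflection_length_mat_1 [simp]: "reflection_length W (mat 1) = 0"
  using reflection_length_le[of "[]"] by simp

lemma reflection_lengthE:
  assumes "set us \<subseteq> reflections W" "w = matrix_prod us"
  obtains ts where "length ts = reflection_length W w" "set ts \<subseteq> reflections W" "w = matrix_prod ts"
proof -
  have "\<exists>ts. length ts = reflection_length W w \<and> set ts \<subseteq> reflections W \<and> w = matrix_prod ts"
    unfolding reflection_length_def by (rule LeastI_ex) (use assms in blast)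
  then show ?thesis using that by blast
qed

lemma inv_mat_1: "inv\<^bsub>orthogonal_group\<^esub> (mat 1 :: real^'n^'n) = mat 1"
  using inv_orthogonal_group[of "mat 1"] by (simp add: orthogonal_matrix_id transpose_mat)

lemma absolute_le_mat_1: "absolute_le W (mat 1) c"
  by (simp add: absolute_le_def inv_mat_1)

lemma absolute_le_refl: "orthogonal_matrix c \<Longrightarrow> absolute_le W c c"
  by (simp add: absolute_le_def inv_orthogonal_group orthogonal_matrix_transpose_mul)

lemma reflection_along_mult: "reflection_along a *v x = x - (2 * (x \<bullet> a) / (a \<bullet> a)) *\<^sub>R a"
proof -
  have "Vector_Spaces.linear (*s) (*s) (\<lambda>x. x - (2 * (x \<bullet> a) / (a \<bullet> a)) *\<^sub>R a)"
    by unfold_locales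
       (auto simp: algebra_simps add_divide_distrib scalar_mult_eq_scaleR)
  then show ?thesis
    unfolding reflection_along_def by (rule matrix_works)
qed

lemma simple_system_length:
  fixes as :: "(real^'n) list"
  assumes "simple_system W as"
  shows "length as = CARD('n)"
proof -
  have "distinct as" "independent (set as)" "span (set as) = UNIV"
    using assms by (auto simp: simple_system_def)
  then have "card (set as) = dim (UNIV :: (real^'n) set)"
    by (metis dim_span dim_eq_card_independent)
  then show ?thesis
    using \<open>distinct as\<close> by (simp add: distinct_card)
qed

lemma fixed_space_mat_1 [simp]: "fixed_space (mat 1) = UNIV"
  by (auto simp: fixed_space_def)

section \<open>The equations of the fixed locus in rank two\<close>

text \<open>One function is chosen instead of separate roots, so that equal arguments receive the
  same root. The equivariance of the base points rests on this.\<close>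

lemma nth_root_function:
  assumes "m > 0"
  obtains r :: "complex \<Rightarrow> complex" where "\<And>a. r a ^ m = a"
proof -
  have "\<exists>z :: complex. z ^ m = a" for a
  proof (cases "a = 0")
    case False
    then have "card {z. z ^ m = a} \<noteq> 0"
      using card_nth_roots[of a m] assms by simp
    then show ?thesis
      by (metis (mono_tags, lifting) Collect_empty_eq card.empty)
  qed (use assms in auto)
  then show ?thesis using that by metis
qed

text \<open>Kept apart from \<open>dihedral_hsop\<close> because \<open>R\<close> is needed to state
  the assumption \<open>no_zero\<close> there. \<open>R a b\<close> and \<open>R b a\<close> are the
  two members of the system at the point with coordinates \<open>a\<close>,
  \<open>b\<close>.\<close>

locale dihedral_equations =
  fixes m k :: nat and \<alpha> \<beta> \<gamma> :: complex
  assumes m_pos: "m > 0" and k_def: "k = m div 2" and odd_\<beta>: "odd m \<Longrightarrow> \<beta> = 0"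
begin

definition R :: "complex \<Rightarrow> complex \<Rightarrow> complex" where
  "R a b = \<alpha> * a ^ (m + 1) + \<beta> * a ^ (k + 1) * b ^ k + \<gamma> * a * b ^ m"

text \<open>For an \<open>m\<close>-th root of unity \<open>\<zeta>\<close> this is
  \<open>R 1 \<zeta>\<close>, the coefficient of the system on the line of slope
  \<open>\<zeta>\<close>.\<close>

definition D :: "complex \<Rightarrow> complex" where
  "D \<zeta> = \<alpha> + \<beta> * \<zeta> ^ k + \<gamma>"

lemma R_factor: "R a b = a * (\<alpha> * a ^ m + \<beta> * a ^ k * b ^ k + \<gamma> * b ^ m)"
  by (simp add: R_def algebra_simps)

text \<open>For even \<open>m\<close> the two factors \<open>a ^ k\<close> combine to
  \<open>a ^ m\<close>; for odd \<open>m\<close> both sides vanish with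
  \<open>\<beta>\<close>.\<close>

lemma \<beta>_power: "\<beta> * a ^ k * (a * c) ^ k = \<beta> * a ^ m * c ^ k"
proof (cases "even m")
  case True
  then have "a ^ m = a ^ k * a ^ k"
    by (simp add: k_def flip: power_add mult_2)
  then show ?thesis by (simp add: power_mult_distrib)
qed (simp add: odd_\<beta>)

lemma \<beta>_power': "\<beta> * (a * c) ^ k * a ^ k = \<beta> * a ^ m * c ^ k"
  using \<beta>_power[of a c] by (simp add: mult_ac)

text \<open>On the line \<open>b = a * \<zeta>\<close> the two fixed point equations thus become one
  and the same condition \<open>D \<zeta> * a ^ m = 1\<close> for \<open>a\<close> nonzero.\<close>

lemma R_ratio:
  assumes "\<zeta> ^ m = 1"
  shows "R a (a * \<zeta>) = a * (D \<zeta> * a ^ m)" and "R (a * \<zeta>) a = a * \<zeta> * (D \<zeta> * a ^ m)"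
proof -
  show "R a (a * \<zeta>) = a * (D \<zeta> * a ^ m)"
    unfolding R_factor D_def \<beta>_power by (simp add: assms power_mult_distrib algebra_simps)
  show "R (a * \<zeta>) a = a * \<zeta> * (D \<zeta> * a ^ m)"
    unfolding R_factor D_def \<beta>_power' by (simp add: assms power_mult_distrib algebra_simps)
qed

text \<open>For even \<open>m\<close> the factor picked up is \<open>\<eta> ^ m\<close>. Rotations
  in \<open>W\<close> move the slope of a mirror by such squares, so \<open>D\<close> is constant
  along their orbits.\<close>

lemma D_mult_square:
  assumes "\<eta> ^ m = 1"
  shows "D (\<zeta> * \<eta>\<^sup>2) = D \<zeta>"
proof (cases "even m")
  case True
  then have "(\<eta>\<^sup>2) ^ k = 1"
    using assms by (simp add: k_def flip: power_mult)
  then show ?thesis by (simp add: D_def power_mult_distrib)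
next
  case False
  then show ?thesis
    using odd_\<beta> by (simp only: D_def) simp
qed

text \<open>The case \<open>k = 0\<close> is delicate because \<open>0 ^ 0 = 1\<close>; it forces
  \<open>m = 1\<close>, which is odd, so \<open>\<beta>\<close> vanishes.\<close>

lemma \<beta>_zero: "\<beta> * a ^ k * 0 ^ k = 0"
proof (cases "k = 0")
  case True
  then have "m = 1"
    using m_pos unfolding k_def by linarith
  then have "\<beta> = 0"
    using odd_\<beta> by fastforce
  then show ?thesis by simp
qed (simp add: zero_power)

lemma D_inverse:
  assumes "\<zeta> ^ m = 1"
  shows "D (inverse \<zeta>) = D \<zeta>"
proof -
  have "\<zeta> \<noteq> 0"
    using assms m_pos by (auto simp: zero_power)
  then have "inverse \<zeta> * \<zeta>\<^sup>2 = \<zeta>"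
    by (simp add: power2_eq_square)
  then show ?thesis
    using D_mult_square[OF assms, of "inverse \<zeta>"] by simp
qed

end

locale dihedral_hsop = dihedral_equations +
  assumes no_zero: "\<And>a b. R a b = 0 \<Longrightarrow> R b a = 0 \<Longrightarrow> a = 0 \<and> b = 0"
begin

lemma \<alpha>_nonzero: "\<alpha> \<noteq> 0"
proof
  assume "\<alpha> = 0"
  then have "R 1 0 = 0" "R 0 1 = 0"
    using \<beta>_zero[of 1] m_pos unfolding R_factor by (simp_all add: zero_power)
  then show False
    using no_zero[of 1 0] by simp
qed

lemma D_nonzero:
  assumes "\<zeta> ^ m = 1"
  shows "D \<zeta> \<noteq> 0"
  using no_zero[of 1 \<zeta>] R_ratio[OF assms, of 1] by auto

text \<open>If they agreed, \<open>R 1 b\<close> and \<open>R b 1\<close> would be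
  \<open>p b\<close> and \<open>b * p b\<close> for the same polynomial \<open>p\<close> of degree
  \<open>m\<close>, and a complex root of \<open>p\<close> would give a nontrivial common
  zero.\<close>

lemma \<alpha>_neq_\<gamma>: "\<alpha> \<noteq> \<gamma>"
proof
  assume \<gamma>: "\<alpha> = \<gamma>"
  define p where "p = [:\<alpha>:] + Polynomial.monom \<beta> k + Polynomial.monom \<alpha> m"
  have poly_p: "poly p b = \<alpha> + \<beta> * b ^ k + \<alpha> * b ^ m" for b
    by (simp add: p_def Polynomial.poly_monom)
  \<comment> \<open>Since \<open>k < m\<close>, neither the \<open>\<beta>\<close> term nor the
    constant term reaches degree \<open>m\<close>.\<close>
  have "Polynomial.coeff p m = \<alpha>"
    using m_pos by (auto simp: p_def k_def Polynomial.coeff_pCons split: nat.split)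
  then have "Polynomial.degree p \<ge> m"
    using \<alpha>_nonzero by (intro Polynomial.le_degree) simp
  then have "\<not> constant (poly p)"
    using m_pos by (simp add: constant_degree)
  then obtain b where "poly p b = 0"
    using fundamental_theorem_of_algebra by blast
  moreover have "R 1 b = \<alpha> + \<beta> * b ^ k + \<gamma> * b ^ m" "R b 1 = b * (\<alpha> * b ^ m + \<beta> * b ^ k + \<gamma>)"
    unfolding R_factor by simp_all
  moreover have "\<gamma> * b ^ m = \<alpha> * b ^ m" "\<alpha> * b ^ m + \<beta> * b ^ k + \<gamma> = poly p b"
    unfolding poly_p using \<gamma> by simp_all
  ultimately have "R 1 b = 0" "R b 1 = 0"
    using poly_p[of b] by simp_all
  then show False
    using no_zero[of 1 b] by simp
qed

text \<open>The fixed locus of the system in eigencoordinates.\<close>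

definition solutions :: "(complex \<times> complex) set" where
  "solutions = {(a, b). R a b = a \<and> R b a = b}"

text \<open>On an axis the equations collapse to \<open>\<alpha> * a ^ m = 1\<close>. Off the axes,
  dividing by the coordinates and subtracting shows that \<open>b / a\<close> is an
  \<open>m\<close>-th root of unity, and \<open>R_ratio\<close> finishes.\<close>

lemma solutions_eq:
  "solutions = {(0, 0)} \<union> (\<lambda>a. (a, 0)) ` {a. a ^ m = 1 / \<alpha>} \<union> Pair 0 ` {b. b ^ m = 1 / \<alpha>} \<union>
     (\<lambda>(\<zeta>, a). (a, a * \<zeta>)) ` (SIGMA \<zeta>:{\<zeta>. \<zeta> ^ m = 1}. {a. a ^ m = 1 / D \<zeta>})"
  (is "_ = ?S")
proof (intro equalityI subsetI)
  fix p assume "p \<in> solutions"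
  then obtain a b where p: "p = (a, b)" and eqs: "R a b = a" "R b a = b"
    by (auto simp: solutions_def)
  show "p \<in> ?S"
  proof (cases "a = 0 \<or> b = 0")
    case True
    have "a ^ m = 1 / \<alpha>" if "R a 0 = a" "a \<noteq> 0" for a
    proof -
      have "\<alpha> * a ^ m = 1"
        using that m_pos \<beta>_zero[of a] by (simp add: R_factor zero_power)
      then show ?thesis
        using \<alpha>_nonzero by (simp add: field_simps)
    qed
    then show ?thesis
      using True eqs unfolding p by auto
  next
    case False
    then have *: "\<alpha> * a ^ m + \<beta> * a ^ k * b ^ k + \<gamma> * b ^ m = 1"
      "\<alpha> * b ^ m + \<beta> * b ^ k * a ^ k + \<gamma> * a ^ m = 1"
      using eqs by (auto simp: R_factor)
    \<comment> \<open>The \<open>\<beta>\<close> terms are symmetric and cancel, so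
      \<open>\<alpha> \<noteq> \<gamma>\<close> forces \<open>a ^ m = b ^ m\<close>.\<close>
    have "(\<alpha> - \<gamma>) * (a ^ m - b ^ m) =
        (\<alpha> * a ^ m + \<beta> * a ^ k * b ^ k + \<gamma> * b ^ m) - (\<alpha> * b ^ m + \<beta> * b ^ k * a ^ k + \<gamma> * a ^ m)"
      by (simp add: algebra_simps)
    then have "a ^ m = b ^ m"
      using * \<alpha>_neq_\<gamma> by simp
    then have \<zeta>: "(b / a) ^ m = 1"
      using False by (simp add: power_divide)
    have b: "b = a * (b / a)"
      using False by simp
    have "D (b / a) * a ^ m = 1"
      using R_ratio(1)[OF \<zeta>, of a] eqs(1) False by (simp flip: b)
    then have "a ^ m = 1 / D (b / a)"
      using D_nonzero[OF \<zeta>] by (simp add: field_simps)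
    then show ?thesis
      unfolding p using \<zeta> b by (intro UnI2 image_eqI[of _ _ "(b / a, a)"]) auto
  qed
next
  have axis: "R a 0 = a \<and> R 0 a = 0" if "a ^ m = 1 / \<alpha>" for a
    using that m_pos \<alpha>_nonzero \<beta>_zero[of a] by (simp add: R_factor zero_power)
  have diag: "R a (a * \<zeta>) = a \<and> R (a * \<zeta>) a = a * \<zeta>" if "\<zeta> ^ m = 1" "a ^ m = 1 / D \<zeta>" for a \<zeta>
    using R_ratio[OF that(1), of a] D_nonzero[OF that(1)] that(2) by simp
  fix p assume "p \<in> ?S"
  then show "p \<in> solutions"
    using axis diag R_factor[of 0 0] by (auto simp: solutions_def)
qed

text \<open>All roots involved are nonzero, hence the four pieces of \<open>solutions_eq\<close> are
  disjoint and contribute \<open>1\<close>, \<open>m\<close>, \<open>m\<close> and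
  \<open>m * m\<close>.\<close>

lemma card_solutions: "card solutions = (m + 1) ^ 2"
proof -
  let ?A = "{a. a ^ m = 1 / \<alpha>}"
  let ?B = "SIGMA \<zeta>:{\<zeta>. \<zeta> ^ m = 1}. {a. a ^ m = 1 / D \<zeta>}"
  let ?f = "\<lambda>(\<zeta>, a). (a, a * \<zeta>) :: complex \<times> complex"
  have nz: "z \<noteq> 0" if "z ^ m = y" "y \<noteq> 0" for y z :: complex
    using that m_pos by (auto simp: zero_power)
  have A: "finite ?A" "card ?A = m"
    using \<alpha>_nonzero m_pos by (auto simp: card_nth_roots intro!: finite_nth_roots)
  have U: "finite {\<zeta>::complex. \<zeta> ^ m = 1}" "card {\<zeta>::complex. \<zeta> ^ m = 1} = m"
    using m_pos by (auto simp: card_nth_roots intro!: finite_nth_roots)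
  have B: "finite ?B"
    using U m_pos by (intro finite_SigmaI) (auto intro!: finite_nth_roots)
  have "card ?B = (\<Sum>\<zeta>\<in>{\<zeta>. \<zeta> ^ m = 1}. card {a. a ^ m = 1 / D \<zeta>})"
    using U m_pos by (intro card_SigmaI) (auto intro!: finite_nth_roots)
  also have "\<dots> = (\<Sum>\<zeta>\<in>{\<zeta>::complex. \<zeta> ^ m = 1}. m)"
    using D_nonzero m_pos by (intro sum.cong refl card_nth_roots) auto
  also have "\<dots> = m * m"
    using U by simp
  finally have cB: "card ?B = m * m" .
  have B_nz: "a \<noteq> 0" if "(\<zeta>, a) \<in> ?B" for \<zeta> a
    using that nz[of a] D_nonzero[of \<zeta>] by auto
  have "inj_on ?f ?B"
  proof (rule inj_onI)
    fix p p' assume "p \<in> ?B" "p' \<in> ?B" "?f p = ?f p'"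
    then show "p = p'"
      using B_nz[of "fst p" "snd p"] by (auto simp: prod_eq_iff)
  qed
  then have fB: "card (?f ` ?B) = m * m"
    using cB by (simp add: card_image)
  have A1: "card ((\<lambda>a. (a, 0::complex)) ` ?A) = m" and A2: "card (Pair (0::complex) ` ?A) = m"
    using A by (auto simp: card_image inj_on_def)
  have "card ({(0::complex, 0::complex)} \<union> (\<lambda>a. (a, 0)) ` ?A) = 1 + m"
    using A A1 nz[of 0 "1 / \<alpha>"] \<alpha>_nonzero by (subst card_Un_disjoint) auto
  then have "card ({(0, 0)} \<union> (\<lambda>a. (a, 0)) ` ?A \<union> Pair 0 ` ?A) = 1 + m + m"
    using A A2 nz[of 0 "1 / \<alpha>"] \<alpha>_nonzero by (subst card_Un_disjoint) auto
  then have "card ({(0, 0)} \<union> (\<lambda>a. (a, 0)) ` ?A \<union> Pair 0 ` ?A \<union> ?f ` ?B) = 1 + m + m + m * m"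
  proof (subst card_Un_disjoint)
    show "({(0, 0)} \<union> (\<lambda>a. (a, 0)) ` ?A \<union> Pair 0 ` ?A) \<inter> ?f ` ?B = {}"
    proof -
      have "a \<noteq> 0 \<and> a * \<zeta> \<noteq> 0" if "(\<zeta>, a) \<in> ?B" for \<zeta> a
        using B_nz[OF that] that nz[of \<zeta> 1] by auto
      then show ?thesis by force
    qed
  qed (use A B fB in auto)
  then show ?thesis
    unfolding solutions_eq by (simp add: power2_eq_square)
qed

end

section \<open>Rank one\<close>

text \<open>Here \<open>W\<close> consists of plus and minus the identity, \<open>h = 2\<close>, and
  the system is a nonzero multiple \<open>t\<close> of the cube of the coordinate. Its fixed points
  are 0 and the two square roots of \<open>1 / t\<close>, matching the flats \<open>{0}\<close> and
  \<open>UNIV\<close>.\<close>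

lemma rank_one:
  fixes W :: "(real^'n^'n) set" and x \<theta> :: "'n \<Rightarrow> complex^'n \<Rightarrow> complex"
  assumes W: "subgroup W orthogonal_group"
    and n: "CARD('n) = 1"
    and simple: "simple_system W as"
    and c: "c = coxeter_element as"
    and h: "h = group.ord orthogonal_group c"
    and x: "is_dual_basis x"
    and \<theta>: "admissible_hsop W h x \<theta>"
  shows "card (V_Theta x \<theta>) = (h + 1) ^ CARD('n) \<and>
         (\<exists>F. equivariant_bijection W c h (V_Theta x \<theta>) F)"
proof -
  note WD = subgroup_orthogonal_groupD[OF W]
  obtain i :: 'n where i: "UNIV = {i}"
    using n card_1_singletonE by blast
  have all_i: "k = i" for k
    using i by blast
  have vec1: "X = Y \<longleftrightarrow> X $ i = Y $ i" for X Y :: "'b^'n"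
    by (metis all_i vec_eq_iff)
  have mat_mult: "A *v y = (A $ i $ i) *s y" for A :: "'b::comm_ring_1^'n^'n" and y
    by (simp add: vec1 matrix_vector_mult_def i)
  have mat_eq: "A = B \<longleftrightarrow> A $ i $ i = B $ i $ i" for A B :: "'b^'n^'n"
    by (simp add: vec1)
  obtain a where as: "as = [a]"
    using simple_system_length[OF simple] n by (auto simp: length_Suc_conv)
  then have a: "a \<in> unit_roots W"
    using simple by (simp add: simple_system_def)
  have "a $ i \<noteq> 0"
    using a by (metis (mono_tags, lifting) mem_Collect_eq norm_zero unit_roots_def vec1 zero_index zero_neq_one)
  then have "reflection_along a *v axis i 1 = - axis i 1"
    by (simp add: reflection_along_mult vec1 inner_vec_def i axis_def)
  then have "reflection_along a $ i $ i = - 1"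
    by (simp add: mat_mult vec1 axis_def)
  moreover have c_a: "c = reflection_along a"
    by (simp add: c as coxeter_element_def)
  ultimately have c_eq: "c = - mat 1"
    by (simp add: mat_eq mat_def)
  have cW: "c \<in> W"
    using a by (simp add: unit_roots_def c_a)
  have W_eq: "w = mat 1 \<or> w = c" if "w \<in> W" for w
  proof -
    have "w $ i $ i * w $ i $ i = 1"
      using WD(1)[OF that]
      by (simp add: orthogonal_matrix_def mat_eq matrix_matrix_mult_def transpose_def i mat_def)
    then show ?thesis
      unfolding c_eq mat_eq by (simp add: mat_def square_eq_1_iff)
  qed
  have pow: "c [^]\<^bsub>orthogonal_group\<^esub> n = (if even n then mat 1 else c)" for n :: nat
  proof (induction n)
    case (Suc n)
    then show ?case
      using group.is_monoid[OF group_orthogonal_group]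
      by (auto simp: monoid.nat_pow_Suc mat_eq c_eq matrix_matrix_mult_def i mat_def)
  qed simp
  have "c \<noteq> mat 1"
    by (simp add: c_eq mat_eq mat_def)
  \<comment> \<open>The order is recognised by its multiples, the exponents that kill
    \<open>c\<close>.\<close>
  have h2: "h = 2"
  proof -
    have "2 dvd n \<longleftrightarrow> h dvd n" for n
      using group.pow_eq_id[OF group_orthogonal_group, of c n] \<open>c \<noteq> mat 1\<close> WD(1)[OF cW]
      unfolding h pow by (auto split: if_splits)
    then show ?thesis
      by (metis dvd_antisym dvd_refl)
  qed
  have orth_c: "orthogonal_matrix c"
    using WD(1) cW by blast
  have fixed_c: "fixed_space c = {0}"
    by (auto simp: fixed_space_def mat_mult c_eq mat_def vec1)
  have NC: "noncrossing_flats W c = {UNIV, {0}}"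
  proof -
    have "{w \<in> W. absolute_le W w c} = {mat 1, c}"
      using absolute_le_mat_1 absolute_le_refl[OF orth_c] W_eq WD(3) cW by blast
    then show ?thesis
      by (simp add: noncrossing_flats_def fixed_c)
  qed
  have UNIV_neq: "UNIV \<noteq> {0 :: real^'n}"
    by (metis UNIV_I axis_eq_0_iff singletonD zero_neq_one)
  define u :: "complex^'n \<Rightarrow> complex" where "u z = z $ i" for z
  have span_u: "cfun.span {u} = dual_space"
  proof (intro equalityI subsetI)
    fix f assume "f \<in> cfun.span {u}"
    then obtain k where "f = (\<lambda>z. k * u z)"
      by (auto simp: cfun.span_singleton fun_scale_def)
    then show "f \<in> dual_space"
      unfolding dual_space_iff by (auto simp: u_def i)
  next
    fix f :: "complex^'n \<Rightarrow> complex" assume "f \<in> dual_space"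
    then obtain k where "f = fun_scale k u"
      by (auto simp: dual_space_iff u_def i fun_scale_def)
    then show "f \<in> cfun.span {u}"
      by (metis cfun.span_base cfun.span_scale singletonI)
  qed
  obtain \<phi> where
    \<phi>: "\<And>f. f \<in> dual_space \<Longrightarrow> \<phi> f \<in> homogeneous_part (h + 1)"
       "\<And>z. (\<And>f. f \<in> {u} \<Longrightarrow> \<phi> f z = 0) \<Longrightarrow> z = 0"
       "V_Theta x \<theta> = {z. \<forall>f\<in>{u}. \<phi> f z = f z}"
    by (rule admissible_hsopE[OF x \<theta> span_u]) blast
  define t where "t = \<phi> u (axis i 1)"
  have "\<phi> u \<in> homogeneous_part 3"
    using \<phi>(1)[of u] span_u cfun.span_base[of u "{u}"] by (simp add: h2 numeral_3_eq_3)
  have \<phi>u: "\<phi> u z = t * (z $ i) ^ 3" for z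
  proof -
    have "(z $ i) *s axis i 1 = z"
      by (simp add: vec1 axis_def)
    then show ?thesis
      using homogeneous_part_scale[OF \<open>\<phi> u \<in> homogeneous_part 3\<close>, of "z $ i" "axis i 1"]
      by (simp add: t_def mult.commute)
  qed
  have "t \<noteq> 0"
    using \<phi>(2)[of "axis i 1"] by (auto simp: t_def axis_eq_0_iff)
  define s where "s = 1 / csqrt t"
  have s: "t * s\<^sup>2 = 1" "s \<noteq> 0"
    using \<open>t \<noteq> 0\<close> by (auto simp: s_def power_divide)
  define q :: "(real^'n) set \<Rightarrow> complex^'n" where "q X = (if X = {0} then 0 else axis i s)" for X
  have V: "V_Theta x \<theta> = {0, axis i s, - axis i s}"
  proof -
    have "t * y ^ 3 = y \<longleftrightarrow> y = 0 \<or> y = s \<or> y = - s" for y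
    proof -
      have "t * y ^ 3 - y = t * (y * (y - s) * (y + s)) + y * (t * s\<^sup>2 - 1)"
        by (simp add: algebra_simps power2_eq_square power3_eq_cube)
      then have "t * y ^ 3 - y = t * (y * (y - s) * (y + s))"
        by (simp add: s)
      then show ?thesis
        using \<open>t \<noteq> 0\<close> by (metis (no_types) add_eq_0_iff2 eq_iff_diff_eq_0 mult_eq_0_iff)
    qed
    then have "V_Theta x \<theta> = {z. z $ i = 0 \<or> z $ i = s \<or> z $ i = - s}"
      unfolding \<phi>(3) by (simp add: \<phi>u u_def)
    also have "\<dots> = {0, axis i s, - axis i s}"
      by (auto simp: vec1 axis_def)
    finally show ?thesis .
  qed
  have "card (V_Theta x \<theta>) = 3"
    using s unfolding V by (auto simp: card_insert_if vec1 axis_def)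
  moreover have "\<exists>F. equivariant_bijection W c h (V_Theta x \<theta>) F"
  proof (rule equivariant_bijection_from_base_points[OF W cW, where q = q])
    have orth_im: "(*v) A ` X = X" if "A = mat 1 \<or> A = c" "X \<in> {UNIV, {0}}" for A X
    proof -
      have "(*v) c = uminus"
        by (simp add: fun_eq_iff c_eq mat_mult mat_def vec1)
      moreover have "range (\<lambda>x :: real^'n. - x) = UNIV"
        by (metis surjI minus_minus)
      ultimately show ?thesis
        using that by auto
    qed
    have tc: "transpose c = c"
      by (simp add: mat_eq transpose_def)
    show "(*v) c ` X \<in> noncrossing_flats W c" "(*v) (transpose c) ` X \<in> noncrossing_flats W c"
      if "X \<in> noncrossing_flats W c" for X
      using orth_im[of c X] that unfolding NC tc by auto
    show "q ((*v) c ` X) = V_action h c 1 (q X)" if "X \<in> noncrossing_flats W c" for X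
    proof -
      \<comment> \<open>For \<open>h = 2\<close> the scalar is -1, which cancels the sign coming
        from \<open>c\<close>.\<close>
      have "V_action h c 1 z = z" for z
        by (simp add: V_action_def h2 mat_mult c_eq complexify_def mat_def vec1)
      then show ?thesis
        using orth_im[of c X] that unfolding NC by auto
    qed
    show "complexify w *v q X = q X' \<longleftrightarrow> X = X' \<and> w \<in> pointwise_stabilizer W X"
      if "w \<in> W" "X \<in> noncrossing_flats W c" "X' \<in> noncrossing_flats W c" for w X X'
    proof -
      have "w $ i $ i = 1 \<and> w = mat 1 \<or> w $ i $ i = - 1 \<and> w = c"
        using W_eq[OF that(1)] by (auto simp: c_eq mat_def)
      moreover have "w \<in> pointwise_stabilizer W UNIV \<longleftrightarrow> w = mat 1"
        using that(1) by (auto simp: pointwise_stabilizer_def matrix_eq)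
      moreover have "w \<in> pointwise_stabilizer W {0}"
        using that(1) by (auto simp: pointwise_stabilizer_def)
      ultimately show ?thesis
        using that(2,3) UNIV_neq s(2) \<open>c \<noteq> mat 1\<close>
        unfolding NC by (auto simp: q_def mat_mult complexify_def vec1 axis_def)
    qed
    show "V_Theta x \<theta> = {complexify w *v q X |w X. w \<in> W \<and> X \<in> noncrossing_flats W c}"
    proof -
      have "W = {mat 1, c}"
        using W_eq WD(3) cW by blast
      moreover have "complexify (mat 1) *v z = z" "complexify c *v z = - z" for z :: "complex^'n"
        by (auto simp: c_eq complexify_def mat_mult mat_def vec1)
      moreover have "{complexify w *v q X |w X. w \<in> W \<and> X \<in> noncrossing_flats W c} =
          (\<Union>w\<in>W. \<Union>X\<in>noncrossing_flats W c. {complexify w *v q X})"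
        by blast
      ultimately have "{complexify w *v q X |w X. w \<in> W \<and> X \<in> noncrossing_flats W c} =
          {q UNIV, q {0}, - q UNIV, - q {0}}"
        unfolding NC by simp blast
      then show ?thesis
        unfolding V q_def using UNIV_neq by auto
    qed
  qed
  ultimately show ?thesis
    by (simp add: h2 n)
qed

section \<open>Orthogonal matrices of the plane\<close>

text \<open>Multiplication by \<open>z\<close> permutes \<open>G\<close>; comparing the products
  over \<open>G\<close> gives \<open>z ^ card G = 1\<close>. Equality follows because there are only
  \<open>card G\<close> such roots.\<close>

lemma finite_multiplicative_group_eq_roots_of_unity:
  fixes G :: "complex set"
  assumes "finite G" "1 \<in> G" "0 \<notin> G" "\<And>x y. x \<in> G \<Longrightarrow> y \<in> G \<Longrightarrow> x * y \<in> G"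
  shows "G = {z. z ^ card G = 1}"
proof (rule card_subset_eq)
  have "card G > 0"
    using assms card_gt_0_iff by blast
  then show "finite {z::complex. z ^ card G = 1}"
    by (intro finite_nth_roots)
  show "card G = card {z::complex. z ^ card G = 1}"
    using \<open>card G > 0\<close> by (simp add: card_nth_roots)
  show "G \<subseteq> {z. z ^ card G = 1}"
  proof
    fix z assume z: "z \<in> G"
    have "inj_on ((*) z) G"
      using z assms(3) by (auto simp: inj_on_def)
    moreover have "(*) z ` G \<subseteq> G"
      using z assms(4) by auto
    ultimately have "bij_betw ((*) z) G G"
      using assms(1) by (simp add: bij_betw_def endo_inj_surj)
    then have "(\<Prod>x\<in>G. z * x) = (\<Prod>x\<in>G. x)"
      by (rule prod.reindex_bij_betw)
    moreover have "(\<Prod>x\<in>G. x) \<noteq> 0"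
      using assms(1,3) by (simp add: prod_zero_iff)
    ultimately show "z \<in> {z. z ^ card G = 1}"
      by (simp add: prod.distrib)
  qed
qed

lemma norm_of_root_of_unity:
  fixes z :: complex
  assumes "z ^ n = 1" "n > 0"
  shows "norm z = 1"
proof (rule power_eq_imp_eq_base)
  show "norm z ^ n = 1 ^ n"
    by (simp add: assms flip: norm_power)
qed (use assms in auto)

text \<open>
  The hypothesis says that all \<open>2M\<close>-th roots of unity lie in \<open>\<plusminus>\<close> the cone spanned by \<open>1\<close> and \<open>\<epsilon>\<close>,
  so \<open>\<epsilon>\<close> must be the last one of them before \<open>-1\<close>.
\<close>
lemma root_of_unity_spanning_cone:
  assumes M: "M > 0" and \<epsilon>: "\<epsilon> ^ (2 * M) = 1" "Im \<epsilon> > 0"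
    and cone: "\<And>\<delta>. \<delta> ^ (2 * M) = 1 \<Longrightarrow> \<exists>k1 k2 :: real. \<delta> = of_real k1 + of_real k2 * \<epsilon> \<and>
      (0 \<le> k1 \<and> 0 \<le> k2 \<or> k1 \<le> 0 \<and> k2 \<le> 0)"
  shows "M \<ge> 2" and "\<epsilon>\<^sup>2 = cis (- (2 * pi / M))"
proof -
  have "\<epsilon> \<in> (\<lambda>k. cis (2 * pi * real k / real (2 * M))) ` {..<2 * M}"
    using \<epsilon>(1) Complex.bij_betw_roots_unity[of "2 * M"] M unfolding bij_betw_def by auto
  then obtain j where j: "j < 2 * M" "\<epsilon> = cis (pi * j / M)"
    by auto
  have sin_pos: "sin (pi * real k / M) > 0" if "0 < k" "k < M" for k
    using that M by (intro sin_gt_zero) (auto simp: field_simps)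
  have "j < M"
  proof (rule ccontr)
    assume "\<not> j < M"
    then have "pi \<le> pi * j / M" "pi * j / M < 2 * pi"
      using j(1) M by (auto simp: field_simps)
    then have "sin (pi * j / M) \<le> 0"
      by (rule sin_le_zero)
    then show False using \<epsilon>(2) j(2) by simp
  qed
  moreover have "j \<noteq> 0"
    using \<epsilon>(2) j(2) by (cases "j = 0") auto
  ultimately show "M \<ge> 2" by linarith
  \<comment> \<open>The last of the roots before -1; the cone condition is applied to it
    alone.\<close>
  define \<delta> where "\<delta> = cis (pi * real (M - 1) / M)"
  have "real (2 * M) * (pi * real (M - 1) / M) = 2 * pi * real (M - 1)"
    using M by simp
  then have "\<delta> ^ (2 * M) = cis (2 * pi * real (M - 1))"
    by (simp only: \<delta>_def Complex.DeMoivre)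
  then have "\<delta> ^ (2 * M) = 1"
    by (simp add: cis_multiple_2pi)
  from cone[OF this] obtain k1 k2 where k: "\<delta> = of_real k1 + of_real k2 * \<epsilon>"
    "0 \<le> k1 \<and> 0 \<le> k2 \<or> k1 \<le> 0 \<and> k2 \<le> 0" by blast
  have "Im \<delta> > 0"
    using sin_pos[of "M - 1"] \<open>M \<ge> 2\<close> by (simp add: \<delta>_def)
  then have "k2 * Im \<epsilon> > 0"
    using k(1) by simp
  then have "k2 > 0"
    using \<epsilon>(2) by (simp add: zero_less_mult_iff)
  then have "k1 \<ge> 0"
    using k(2) by auto
  \<comment> \<open>The sign shows that \<open>\<delta>\<close> does not lie beyond
    \<open>\<epsilon>\<close> in angle, so the index \<open>j\<close> must already be
    \<open>M - 1\<close>.\<close>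
  have "Im (\<delta> * cnj \<epsilon>) = - k1 * Im \<epsilon>"
    by (simp add: k(1) algebra_simps)
  then have "Im (\<delta> * cnj \<epsilon>) \<le> 0"
    using \<open>k1 \<ge> 0\<close> \<epsilon>(2) by (simp add: mult_nonneg_nonneg)
  moreover have "\<delta> * cnj \<epsilon> = cis (pi * real (M - 1 - j) / M)"
  proof -
    have "pi * real (M - 1 - j) / M = pi * real (M - 1) / M + - (pi * j / M)"
      using \<open>j < M\<close>
      by (simp add: of_nat_diff diff_divide_distrib right_diff_distrib add_divide_distrib distrib_left)
    then show ?thesis
      by (simp only: \<delta>_def j(2) cis_cnj cis_mult)
  qed
  ultimately have "\<not> 0 < M - 1 - j"
    using sin_pos[of "M - 1 - j"] M by auto
  then have "j = M - 1"
    using \<open>j < M\<close> by linarith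
  then have "2 * (pi * j / M) = 2 * pi + - (2 * pi / M)"
    using M by (simp add: of_nat_diff field_simps)
  then have "\<epsilon>\<^sup>2 = cis (2 * pi + - (2 * pi / M))"
    by (simp only: j(2) Complex.DeMoivre of_nat_numeral)
  also have "\<dots> = cis (- (2 * pi / M))"
    by (simp only: cis_mult[symmetric] cis_2pi mult_1)
  finally show "\<epsilon>\<^sup>2 = cis (- (2 * pi / M))" .
qed

text \<open>The two indices are parameters because exchanging them reverses the orientation of the
  plane, which later normalises the order of the simple roots.\<close>

locale plane =
  fixes i j :: "'n :: finite"
  assumes i_neq_j: "i \<noteq> j" and UNIV_eq: "(UNIV :: 'n set) = {i, j}"
begin

definition to_complex :: "real^'n \<Rightarrow> complex" where
  "to_complex x = Complex (x $ i) (x $ j)"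

definition of_complex :: "complex \<Rightarrow> real^'n" where
  "of_complex z = (\<chi> k. if k = i then Re z else Im z)"

text \<open>Under \<open>to_complex\<close> this is multiplication by \<open>\<eta>\<close>, and
  \<open>reflection \<eta>\<close> below sends \<open>z\<close> to \<open>\<eta> * cnj z\<close>.
  Products of matrices thereby turn into arithmetic with complex numbers.\<close>

definition rotation :: "complex \<Rightarrow> real^'n^'n" where
  "rotation \<eta> = (\<chi> r s. if r = s then Re \<eta> else if r = j then Im \<eta> else - Im \<eta>)"

definition reflection :: "complex \<Rightarrow> real^'n^'n" where
  "reflection \<eta> = (\<chi> r s. if r \<noteq> s then Im \<eta> else if r = i then Re \<eta> else - Re \<eta>)"

lemma sum_UNIV: "(\<Sum>k\<in>UNIV. f k) = f i + f j"
  using i_neq_j by (simp add: UNIV_eq)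

lemma all_index: "(\<forall>k. P k) \<longleftrightarrow> P i \<and> P j"
  using UNIV_eq by (metis UNIV_I insert_iff singletonD)

lemmas i_neq_j' = i_neq_j i_neq_j[symmetric]

lemma to_complex_of_complex [simp]: "to_complex (of_complex z) = z"
  using i_neq_j' by (simp add: to_complex_def of_complex_def)

lemma to_complex_eq_iff: "to_complex x = to_complex y \<longleftrightarrow> x = y"
  by (simp add: to_complex_def vec_eq_iff all_index)

lemma to_complex_0 [simp]: "to_complex 0 = 0"
  by (simp add: to_complex_def complex_eq_iff)

lemma to_complex_linear:
  "to_complex (x + y) = to_complex x + to_complex y"
  "to_complex (k *\<^sub>R x) = of_real k * to_complex x"
  by (auto simp: to_complex_def complex_eq_iff)

lemma norm_to_complex: "norm (to_complex x) = norm x"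
  by (simp add: to_complex_def norm_vec_def L2_set_def sum_UNIV complex_norm)

lemma to_complex_rotation [simp]: "to_complex (rotation \<eta> *v x) = \<eta> * to_complex x"
  using i_neq_j'
  by (simp add: to_complex_def rotation_def matrix_vector_mult_def sum_UNIV complex_eq_iff algebra_simps)

lemma to_complex_reflection [simp]: "to_complex (reflection \<eta> *v x) = \<eta> * cnj (to_complex x)"
  using i_neq_j'
  by (simp add: to_complex_def reflection_def matrix_vector_mult_def sum_UNIV complex_eq_iff algebra_simps)

lemma matrix_eqI: "(\<And>x. to_complex (A *v x) = to_complex (B *v x)) \<Longrightarrow> A = B"
  by (simp add: matrix_eq to_complex_eq_iff)

lemma rotation_1: "rotation 1 = mat 1"
  by (rule matrix_eqI) simp

lemma composition:
  "rotation a ** rotation b = rotation (a * b)"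
  "rotation a ** reflection b = reflection (a * b)"
  "reflection a ** rotation b = reflection (a * cnj b)"
  "reflection a ** reflection b = rotation (a * cnj b)"
  by (rule matrix_eqI; simp flip: matrix_vector_mul_assoc)+

lemma transpose_rotation: "transpose (rotation \<eta>) = rotation (cnj \<eta>)"
  using i_neq_j' by (simp add: rotation_def transpose_def vec_eq_iff all_index)

lemma transpose_reflection: "transpose (reflection \<eta>) = reflection \<eta>"
  by (auto simp: reflection_def transpose_def vec_eq_iff)

lemma rotation_eq_iff: "rotation a = rotation b \<longleftrightarrow> a = b"
proof
  assume "rotation a = rotation b"
  then have "to_complex (rotation a *v of_complex 1) = to_complex (rotation b *v of_complex 1)"
    by simp
  then show "a = b" by simp
qed simp

lemma rotation_neq_reflection:
  assumes "b \<noteq> 0" shows "rotation a \<noteq> reflection b"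
proof
  assume *: "rotation a = reflection b"
  have "to_complex (rotation a *v of_complex z) = to_complex (reflection b *v of_complex z)" for z
    by (simp add: *)
  from this[of 1] this[of \<i>] show False using assms by simp
qed

text \<open>Orthonormality makes the second column the determinant \<open>e\<close> times the first
  column turned by a right angle, and \<open>e\<close> is 1 or -1.\<close>

lemma orthogonal_matrix_cases:
  assumes "orthogonal_matrix A"
  obtains \<eta> where "norm \<eta> = 1" "A = rotation \<eta> \<or> A = reflection \<eta>"
proof -
  define a b c d where "a = A $ i $ i" and "b = A $ i $ j" and "c = A $ j $ i" and "d = A $ j $ j"
  have "transpose A ** A = mat 1"
    using assms by (simp add: orthogonal_matrix_def)
  then have eqs: "a * a + c * c = 1" "b * b + d * d = 1" "a * b + c * d = 0"
    using i_neq_j'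
    by (auto simp: a_def b_def c_def d_def matrix_matrix_mult_def transpose_def mat_def
        vec_eq_iff all_index sum_UNIV)
  define e where "e = a * d - b * c"
  have "b = b * (a * a + c * c) - a * (a * b + c * d)"
    by (simp add: eqs)
  then have b: "b = - (c * e)"
    by (simp add: e_def algebra_simps)
  have "d = d * (a * a + c * c) - c * (a * b + c * d)"
    by (simp add: eqs)
  then have d: "d = a * e"
    by (simp add: e_def algebra_simps)
  have "e * e = (a * a + c * c) * (b * b + d * d) - (a * b + c * d) * (a * b + c * d)"
    by (simp add: e_def algebra_simps)
  then have "e * e = 1"
    by (simp add: eqs)
  then have "e = 1 \<or> e = - 1"
    by (simp add: square_eq_1_iff)
  then have "A = rotation (Complex a c) \<or> A = reflection (Complex a c)"
    using b d i_neq_j'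
    by (auto simp: rotation_def reflection_def vec_eq_iff all_index a_def b_def c_def d_def)
  moreover have "norm (Complex a c) = 1"
    using eqs(1) by (simp add: complex_norm power2_eq_square)
  ultimately show ?thesis using that by blast
qed

text \<open>For complex numbers with \<open>norm a = 1\<close>, twice the inner product of
  \<open>x\<close> and \<open>a\<close> is \<open>x * cnj a + cnj x * a\<close>; subtracting its
  product with \<open>a\<close> from \<open>x\<close> leaves \<open>- a ^ 2 * cnj x\<close>.\<close>

lemma reflection_along_eq:
  assumes "norm a = 1"
  shows "reflection_along a = reflection (- (to_complex a)\<^sup>2)"
proof (rule matrix_eqI)
  fix x
  have "a $ i * a $ i + a $ j * a $ j = 1"
    using assms by (simp add: norm_vec_def L2_set_def sum_UNIV power2_eq_square)
  then have *: "a $ i * (a $ i * y) + a $ j * (a $ j * y) = y" for y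
    by (metis distrib_right mult.assoc mult_1)
  have "a \<bullet> a = 1"
    using assms by (simp add: dot_square_norm)
  then show "to_complex (reflection_along a *v x) =
      to_complex (reflection (- (to_complex a)\<^sup>2) *v x)"
    unfolding to_complex_reflection reflection_along_mult
    by (simp add: to_complex_def complex_eq_iff inner_vec_def sum_UNIV power2_eq_square algebra_simps)
      (simp add: *)
qed

text \<open>By \<open>reflection_along_eq\<close> the root has to be a square root of
  \<open>- \<eta>\<close>.\<close>

lemma reflection_is_reflection_along:
  assumes "norm \<eta> = 1"
  obtains a where "norm a = 1" "reflection \<eta> = reflection_along a"
proof
  let ?a = "of_complex (csqrt (- \<eta>))"
  have "norm (csqrt (- \<eta>)) ^ 2 = 1"
    by (simp add: assms flip: norm_power)
  then show a: "norm ?a = 1"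
    by (simp add: power2_eq_1_iff flip: norm_to_complex)
  show "reflection \<eta> = reflection_along ?a"
    by (simp add: reflection_along_eq[OF a])
qed

lemma reflection_along_scale:
  assumes "k \<noteq> 0" shows "reflection_along (k *\<^sub>R a) = reflection_along (a :: real^'n)"
  using assms by (simp add: matrix_eq reflection_along_mult)

lemma reflections_eq: "reflections W = {t \<in> W. \<exists>\<eta>. norm \<eta> = 1 \<and> t = reflection \<eta>}"
proof -
  have "(\<exists>a. a \<noteq> 0 \<and> t = reflection_along a) \<longleftrightarrow> (\<exists>\<eta>. norm \<eta> = 1 \<and> t = reflection \<eta>)" for t
  proof
    assume "\<exists>a. a \<noteq> 0 \<and> t = reflection_along a"
    then obtain a where a: "a \<noteq> 0" "t = reflection_along a" by blast
    define b where "b = (1 / norm a) *\<^sub>R a"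
    have b: "norm b = 1" "t = reflection_along b"
      using a by (auto simp: b_def reflection_along_scale)
    then have "norm (- (to_complex b)\<^sup>2) = 1"
      by (simp add: norm_power norm_to_complex)
    then show "\<exists>\<eta>. norm \<eta> = 1 \<and> t = reflection \<eta>"
      using b reflection_along_eq by blast
  next
    assume "\<exists>\<eta>. norm \<eta> = 1 \<and> t = reflection \<eta>"
    then show "\<exists>a. a \<noteq> 0 \<and> t = reflection_along a"
      by (metis norm_zero reflection_is_reflection_along zero_neq_one)
  qed
  then show ?thesis by (auto simp: reflections_def)
qed

end

section \<open>Dihedral groups\<close>

text \<open>
  The scalar \<open>\<mu>\<close> rotates the plane so that the reflections of \<open>W\<close> become
  \<open>z \<mapsto> \<eta> \<cdot> cnj z\<close> with \<open>\<eta> ^ m = 1\<close>.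
\<close>
locale dihedral = plane i j for i j :: "'n :: finite" +
  fixes W :: "(real^'n^'n) set" and m :: nat and \<mu> :: complex and c :: "real^'n^'n"
  assumes subgroup: "subgroup W orthogonal_group"
    and m_ge_3: "m \<ge> 3"
    and norm_\<mu>: "norm \<mu> = 1"
    and rotation_in_W: "\<And>\<eta>. norm \<eta> = 1 \<Longrightarrow> rotation \<eta> \<in> W \<longleftrightarrow> \<eta> ^ m = 1"
    and reflection_in_W: "\<And>\<eta>. norm \<eta> = 1 \<Longrightarrow> reflection \<eta> \<in> W \<longleftrightarrow> (\<mu>\<^sup>2 * \<eta>) ^ m = 1"
    and c_eq: "c = rotation (cnj (cis (2 * pi / m)))"

text \<open>The rotations in \<open>W\<close> form a finite group of unit complex numbers, hence all
  \<open>M\<close>-th roots of unity, and the reflections are a coset of them. Simplicity of the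
  roots fixes the angle between them and hence \<open>c\<close>; irreducibility rules out
  \<open>M = 2\<close>.\<close>

lemma (in plane) dihedralI:
  assumes W: "subgroup W orthogonal_group" "finite W" "acts_irreducibly W"
    and simple: "simple_system W [a1, a2]"
    and orientation: "Im (to_complex a2 * cnj (to_complex a1)) < 0"
  shows "\<exists>m \<mu>. dihedral i j W m \<mu> (coxeter_element [a1, a2])"
proof -
  note WD = subgroup_orthogonal_groupD[OF W(1)]
  define \<alpha>1 \<alpha>2 where "\<alpha>1 = to_complex a1" and "\<alpha>2 = to_complex a2"
  have roots: "a1 \<in> unit_roots W" "a2 \<in> unit_roots W" and "a1 \<noteq> a2"
    and indep: "independent {a1, a2}"
    using simple by (auto simp: simple_system_def)
  have norms: "norm a1 = 1" "norm a2 = 1" "norm \<alpha>1 = 1" "norm \<alpha>2 = 1"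
    using roots by (auto simp: unit_roots_def \<alpha>1_def \<alpha>2_def norm_to_complex)
  have cnj_\<alpha>1: "\<alpha>1 * cnj \<alpha>1 = 1" "cnj \<alpha>1 * \<alpha>1 = 1"
    using norms(3) by (simp_all add: complex_norm_square[symmetric] mult.commute)
  define \<rho> where "\<rho> = - \<alpha>1\<^sup>2"
  have norm_\<rho>: "norm \<rho> = 1"
    using norms by (simp add: \<rho>_def norm_power)
  have cnj_\<rho>: "\<rho> * cnj \<rho> = 1" "cnj \<rho> * \<rho> = 1"
    using norm_\<rho> by (simp_all add: complex_norm_square[symmetric] mult.commute)
  have refl_\<rho>: "reflection \<rho> \<in> W"
    using roots norms reflection_along_eq[of a1] by (simp add: unit_roots_def \<rho>_def \<alpha>1_def)
  define G where "G = {\<eta>. norm \<eta> = 1 \<and> rotation \<eta> \<in> W}"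
  define M where "M = card G"
  have "finite G"
  proof -
    have "inj_on rotation G"
      by (auto simp: inj_on_def rotation_eq_iff)
    moreover have "rotation ` G \<subseteq> W"
      by (auto simp: G_def)
    ultimately show ?thesis
      using W(2) by (meson finite_imageD finite_subset)
  qed
  moreover have "1 \<in> G"
    using WD(3) by (simp add: G_def rotation_1)
  ultimately have "M > 0"
    unfolding M_def using card_gt_0_iff by blast
  have "G = {z. z ^ M = 1}"
    unfolding M_def
  proof (rule finite_multiplicative_group_eq_roots_of_unity)
    show "x * y \<in> G" if "x \<in> G" "y \<in> G" for x y
      using that WD(2)[of "rotation x" "rotation y"] by (simp add: G_def norm_mult composition)
  qed (use \<open>finite G\<close> \<open>1 \<in> G\<close> in \<open>auto simp: G_def\<close>)
  then have rot: "rotation \<eta> \<in> W \<longleftrightarrow> \<eta> ^ M = 1" if "norm \<eta> = 1" for \<eta>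
    using that by (auto simp: G_def)
  \<comment> \<open>Multiplying by the fixed element \<open>reflection \<rho>\<close> of
    \<open>W\<close> exchanges rotations and reflections.\<close>
  have refl: "reflection \<eta> \<in> W \<longleftrightarrow> (cnj \<rho> * \<eta>) ^ M = 1" if "norm \<eta> = 1" for \<eta>
  proof -
    have "reflection \<eta> \<in> W \<longleftrightarrow> rotation (\<eta> * cnj \<rho>) \<in> W"
    proof
      assume "reflection \<eta> \<in> W"
      then show "rotation (\<eta> * cnj \<rho>) \<in> W"
        using WD(2)[OF _ refl_\<rho>] by (simp add: composition flip: composition(4))
    next
      assume "rotation (\<eta> * cnj \<rho>) \<in> W"
      then have "rotation (\<eta> * cnj \<rho>) ** reflection \<rho> \<in> W"
        using WD(2) refl_\<rho> by blast
      then show "reflection \<eta> \<in> W"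
        by (simp add: composition mult.assoc cnj_\<rho>)
    qed
    then show ?thesis
      using rot[of "\<eta> * cnj \<rho>"] that norm_\<rho> by (simp add: norm_mult mult.commute)
  qed
  define \<epsilon> where "\<epsilon> = \<alpha>2 * cnj \<alpha>1"
  have \<alpha>2_eq: "\<alpha>2 = \<alpha>1 * \<epsilon>"
    using cnj_\<alpha>1 by (simp add: \<epsilon>_def)
  have "reflection (- \<alpha>2\<^sup>2) \<in> W"
    using roots norms reflection_along_eq[of a2] by (simp add: unit_roots_def \<alpha>2_def)
  moreover have "norm (- \<alpha>2\<^sup>2) = 1"
    using norms by (simp add: norm_power)
  moreover have "cnj \<rho> * (- \<alpha>2\<^sup>2) = \<epsilon>\<^sup>2"
    by (simp add: \<rho>_def \<epsilon>_def power_mult_distrib mult.commute)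
  ultimately have \<epsilon>_root: "\<epsilon> ^ (2 * M) = 1"
    using refl[of "- \<alpha>2\<^sup>2"] by (simp add: power_mult)
  \<comment> \<open>The vector with complex coordinate \<open>\<alpha>1 * cnj \<delta>\<close> is a
    unit root, and its expansion in the simple roots gives the coefficients. Conjugates appear
    because the orientation makes \<open>Im \<epsilon>\<close> negative, whereas the cone lemma asks
    for a positive imaginary part.\<close>
  have cone: "\<exists>k1 k2 :: real. \<delta> = of_real k1 + of_real k2 * cnj \<epsilon> \<and>
      (0 \<le> k1 \<and> 0 \<le> k2 \<or> k1 \<le> 0 \<and> k2 \<le> 0)" if \<delta>: "\<delta> ^ (2 * M) = 1" for \<delta>
  proof -
    have norm_\<delta>: "norm \<delta> = 1"
      using norm_of_root_of_unity[OF \<delta>] \<open>M > 0\<close> by simp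
    define b where "b = of_complex (\<alpha>1 * cnj \<delta>)"
    have nb: "norm b = 1"
      using norms norm_\<delta> by (simp add: b_def norm_mult flip: norm_to_complex)
    have "cnj \<rho> * (- (\<alpha>1 * cnj \<delta>)\<^sup>2) = (cnj \<alpha>1 * \<alpha>1)\<^sup>2 * (cnj \<delta>)\<^sup>2"
      by (simp add: \<rho>_def power_mult_distrib algebra_simps)
    then have "(cnj \<rho> * (- (\<alpha>1 * cnj \<delta>)\<^sup>2)) ^ M = cnj (\<delta> ^ (2 * M))"
      by (simp add: cnj_\<alpha>1 power_mult)
    then have "reflection_along b \<in> W"
      using refl[of "- (\<alpha>1 * cnj \<delta>)\<^sup>2"] \<delta> norms norm_\<delta>
      unfolding reflection_along_eq[OF nb] by (simp add: b_def norm_power norm_mult)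
    then have "b \<in> unit_roots W"
      using nb by (simp add: unit_roots_def)
    then obtain k where k: "b = (\<Sum>a\<in>set [a1, a2]. k a *\<^sub>R a)"
      "(\<forall>a\<in>set [a1, a2]. 0 \<le> k a) \<or> (\<forall>a\<in>set [a1, a2]. k a \<le> 0)"
      using simple unfolding simple_system_def by blast
    then have "b = k a1 *\<^sub>R a1 + k a2 *\<^sub>R a2"
      using \<open>a1 \<noteq> a2\<close> by simp
    then have "\<alpha>1 * cnj \<delta> = of_real (k a1) * \<alpha>1 + of_real (k a2) * \<alpha>2"
      by (metis \<alpha>1_def \<alpha>2_def b_def to_complex_linear to_complex_of_complex)
    then have "\<alpha>1 * cnj \<delta> = \<alpha>1 * (of_real (k a1) + of_real (k a2) * \<epsilon>)"
      by (simp add: \<alpha>2_eq algebra_simps)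
    moreover have "\<alpha>1 \<noteq> 0"
      using norms by auto
    ultimately have "cnj \<delta> = of_real (k a1) + of_real (k a2) * \<epsilon>"
      by simp
    then have "\<delta> = of_real (k a1) + of_real (k a2) * cnj \<epsilon>"
      by (metis complex_cnj_add complex_cnj_cnj complex_cnj_complex_of_real complex_cnj_mult)
    then show ?thesis
      using k(2) by auto
  qed
  have "(cnj \<epsilon>) ^ (2 * M) = 1"
    using \<epsilon>_root by (metis complex_cnj_one complex_cnj_power)
  moreover have "Im (cnj \<epsilon>) > 0"
    using orientation by (simp add: \<epsilon>_def \<alpha>1_def \<alpha>2_def)
  ultimately have M2: "M \<ge> 2" and \<epsilon>2: "(cnj \<epsilon>)\<^sup>2 = cis (- (2 * pi / M))"
    using root_of_unity_spanning_cone[OF \<open>M > 0\<close> _ _ cone] by blast+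
  have c_eq: "coxeter_element [a1, a2] = rotation (cnj (cis (2 * pi / M)))"
  proof -
    have "coxeter_element [a1, a2] = rotation (\<alpha>1\<^sup>2 * cnj (\<alpha>2\<^sup>2))"
      using norms by (simp add: coxeter_element_def reflection_along_eq composition \<alpha>1_def \<alpha>2_def)
    moreover have "\<alpha>1\<^sup>2 * cnj (\<alpha>2\<^sup>2) = (cnj \<epsilon>)\<^sup>2"
      by (simp add: \<epsilon>_def power_mult_distrib mult.commute)
    ultimately show ?thesis
      using \<epsilon>2 by (simp add: cis_cnj)
  qed
  \<comment> \<open>For \<open>M = 2\<close> every element sends \<open>a1\<close> to plus or minus
    itself, so its span would be a proper invariant line.\<close>
  have "M \<noteq> 2"
  proof
    assume "M = 2"
    have "w *v a1 = a1 \<or> w *v a1 = - a1" if w: "w \<in> W" for w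
    proof -
      from orthogonal_matrix_cases[OF WD(1)[OF w]] obtain \<eta> where
        \<eta>: "norm \<eta> = 1" "w = rotation \<eta> \<or> w = reflection \<eta>" .
      have "to_complex (w *v a1) = \<alpha>1 \<or> to_complex (w *v a1) = - \<alpha>1"
        using \<eta>(2)
      proof
        assume "w = rotation \<eta>"
        then have "\<eta> = 1 \<or> \<eta> = - 1"
          using rot[OF \<eta>(1)] w \<open>M = 2\<close> by (simp add: power2_eq_1_iff)
        then show ?thesis
          using \<open>w = rotation \<eta>\<close> by (auto simp: \<alpha>1_def)
      next
        assume w_eq: "w = reflection \<eta>"
        then have "cnj \<rho> * \<eta> = 1 \<or> cnj \<rho> * \<eta> = - 1"
          using refl[OF \<eta>(1)] w \<open>M = 2\<close> by (simp add: power2_eq_1_iff)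
        then have "\<eta> = \<rho> \<or> \<eta> = - \<rho>"
          using cnj_\<rho> by (metis mult.assoc mult.left_neutral mult_1_right mult_minus1_right)
        moreover have "\<rho> * cnj \<alpha>1 = - \<alpha>1"
          using cnj_\<alpha>1 by (simp add: \<rho>_def power2_eq_square mult.assoc)
        ultimately show ?thesis
          using w_eq by (auto simp: \<alpha>1_def)
      qed
      moreover have "- \<alpha>1 = to_complex (- a1)"
        by (simp add: \<alpha>1_def to_complex_def complex_eq_iff)
      ultimately show ?thesis
        by (metis \<alpha>1_def to_complex_eq_iff)
    qed
    then have "(*v) w ` span {a1} \<subseteq> span {a1}" if "w \<in> W" for w
      using that
      by (auto simp: span_singleton matrix_vector_mult_scaleR)
        (metis rangeI scaleR_minus_left scaleR_minus_right)
    then have "span {a1} = {0} \<or> span {a1} = UNIV"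
      using W(3) unfolding acts_irreducibly_def by blast
    moreover have "a1 \<noteq> 0"
      using norms by auto
    moreover have "a2 \<notin> span {a1}"
      using indep \<open>a1 \<noteq> a2\<close> by (metis doubleton_eq_iff independent_insert insertI1 insert_commute singletonD)
    ultimately show False
      using span_base by blast
  qed
  then have M3: "M \<ge> 3"
    using M2 by linarith
  \<comment> \<open>A square root of \<open>cnj \<rho>\<close>, so that multiplication by
    \<open>\<mu>\<close> brings the reflection parameters of \<open>W\<close> to \<open>M\<close>-th
    roots of unity.\<close>
  define \<mu> where "\<mu> = csqrt (cnj \<rho>)"
  have \<mu>2: "\<mu>\<^sup>2 = cnj \<rho>"
    by (simp add: \<mu>_def)
  have "(norm \<mu>)\<^sup>2 = 1"
    using norm_\<rho> by (simp add: \<mu>2 flip: norm_power)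
  then have "norm \<mu> = 1"
    using power2_eq_imp_eq[of "norm \<mu>" 1] by simp
  then have "dihedral i j W M \<mu> (coxeter_element [a1, a2])"
    using W(1) M3 rot refl c_eq
    by (intro dihedral.intro dihedral_axioms.intro plane_axioms) (auto simp: \<mu>2)
  then show ?thesis by blast
qed

context dihedral
begin

section \<open>Eigencoordinates of the Coxeter element\<close>

text \<open>On real vectors \<open>u\<close> is the complex coordinate \<open>coord\<close> and
  \<open>v\<close> its conjugate; on the complexification they are independent. A rotation by
  \<open>\<eta>\<close> scales them by \<open>\<eta>\<close> and \<open>cnj \<eta>\<close>.\<close>

definition u :: "complex^'n \<Rightarrow> complex" where
  "u z = \<mu> * (z $ i + \<i> * z $ j)"

definition v :: "complex^'n \<Rightarrow> complex" where
  "v z = cnj \<mu> * (z $ i - \<i> * z $ j)"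

definition point :: "complex \<Rightarrow> complex \<Rightarrow> complex^'n" where
  "point a b = (\<chi> k. if k = i then (cnj \<mu> * a + \<mu> * b) / 2 else (cnj \<mu> * a - \<mu> * b) / (2 * \<i>))"

text \<open>The reflection that acts on \<open>coord\<close> as \<open>z\<close> to
  \<open>\<nu> * cnj z\<close>; the factor undoes the change of phase by
  \<open>\<mu>\<close>.\<close>

definition mirror :: "complex \<Rightarrow> real^'n^'n" where
  "mirror \<nu> = reflection ((cnj \<mu>)\<^sup>2 * \<nu>)"

definition coord :: "real^'n \<Rightarrow> complex" where
  "coord x = \<mu> * to_complex x"

text \<open>For an \<open>m\<close>-th root of unity this is the fixed line of
  \<open>mirror (cnj \<zeta>)\<close>. Its complexification is given by
  \<open>v = \<zeta> * u\<close>, so it contains the fixed points with coordinates \<open>a\<close>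
  and \<open>a * \<zeta>\<close>.\<close>

definition flat :: "complex \<Rightarrow> (real^'n) set" where
  "flat \<zeta> = {x. cnj (coord x) = \<zeta> * coord x}"

abbreviation \<omega> :: complex where
  "\<omega> \<equiv> cis (2 * pi / m)"

lemma \<mu>_cnj [simp]: "\<mu> * cnj \<mu> = 1" "cnj \<mu> * \<mu> = 1"
  using norm_\<mu> by (simp_all add: complex_norm_square[symmetric] mult.commute)

lemma \<mu>_cnj' [simp]: "\<mu> * (cnj \<mu> * z) = z" "cnj \<mu> * (\<mu> * z) = z"
  by (simp_all flip: mult.assoc)

lemma m_pos: "m > 0"
  using m_ge_3 by simp

lemma root_norm: "\<eta> ^ m = 1 \<Longrightarrow> norm (\<eta> :: complex) = 1"
  using norm_of_root_of_unity m_pos by blast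

lemma root_cnj:
  assumes "\<eta> ^ m = 1"
  shows "\<eta> * cnj \<eta> = 1" "cnj \<eta> * \<eta> = 1" "cnj \<eta> ^ m = 1" "\<eta> \<noteq> 0"
proof -
  show "\<eta> * cnj \<eta> = 1"
    using root_norm[OF assms] by (simp add: complex_norm_square[symmetric])
  then show "cnj \<eta> * \<eta> = 1" "\<eta> \<noteq> 0"
    by (auto simp: mult.commute)
  show "cnj \<eta> ^ m = 1"
    using assms by (metis complex_cnj_one complex_cnj_power)
qed

lemma u_point [simp]: "u (point a b) = a" and v_point [simp]: "v (point a b) = b"
  using i_neq_j' by (simp_all add: u_def v_def point_def field_simps)

lemma point_u_v [simp]: "point (u z) (v z) = z"
  using i_neq_j' by (simp add: u_def v_def point_def vec_eq_iff all_index field_simps)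

lemma point_eq_iff: "point a b = point a' b' \<longleftrightarrow> a = a' \<and> b = b'"
  by (metis u_point v_point)

lemma point_0: "point 0 0 = 0"
  by (simp add: point_def vec_eq_iff)

lemma scale_point: "k *s point a b = point (k * a) (k * b)"
  by (simp add: point_def vec_eq_iff all_index algebra_simps diff_divide_distrib add_divide_distrib)

lemma eqI_u_v: "u z = u z' \<Longrightarrow> v z = v z' \<Longrightarrow> z = z'"
  by (metis point_u_v)

lemma rotation_point: "complexify (rotation \<eta>) *v point a b = point (\<eta> * a) (cnj \<eta> * b)"
proof (cases \<eta>)
  case (Complex r s)
  have "u (complexify (rotation \<eta>) *v z) = \<eta> * u z"
    "v (complexify (rotation \<eta>) *v z) = cnj \<eta> * v z" for z
    using i_neq_j'
    by (simp_all add: Complex u_def v_def complexify_def rotation_def matrix_vector_mult_def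
        sum_UNIV complex_cnj Complex_eq algebra_simps)
  then show ?thesis
    by (intro eqI_u_v) simp_all
qed

lemma mirror_point: "complexify (mirror \<nu>) *v point a b = point (\<nu> * b) (cnj \<nu> * a)"
proof -
  have "u (complexify (reflection \<eta>) *v z) = \<mu>\<^sup>2 * \<eta> * v z"
      "v (complexify (reflection \<eta>) *v z) = (cnj \<mu>)\<^sup>2 * cnj \<eta> * u z" for \<eta> z
  proof -
    obtain r s where Complex: "\<eta> = Complex r s"
      by (cases \<eta>)
    have "u (complexify (reflection \<eta>) *v z) = \<mu> * (\<eta> * (z $ i - \<i> * z $ j))"
      "v (complexify (reflection \<eta>) *v z) = cnj \<mu> * (cnj \<eta> * (z $ i + \<i> * z $ j))"
      using i_neq_j'
      by (simp_all add: Complex u_def v_def complexify_def reflection_def matrix_vector_mult_def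
          sum_UNIV complex_cnj Complex_eq algebra_simps)
    moreover have "\<mu>\<^sup>2 * \<eta> * v z = \<mu> * (\<eta> * (z $ i - \<i> * z $ j))"
      "(cnj \<mu>)\<^sup>2 * cnj \<eta> * u z = cnj \<mu> * (cnj \<eta> * (z $ i + \<i> * z $ j))"
      by (simp_all add: u_def v_def power2_eq_square mult_ac)
    ultimately show "u (complexify (reflection \<eta>) *v z) = \<mu>\<^sup>2 * \<eta> * v z"
      "v (complexify (reflection \<eta>) *v z) = (cnj \<mu>)\<^sup>2 * cnj \<eta> * u z"
      by (simp_all only:)
  qed
  then show ?thesis
    unfolding mirror_def by (intro eqI_u_v) (simp_all add: power2_eq_square mult_ac)
qed

lemma coord_mult:
  "coord (rotation \<eta> *v x) = \<eta> * coord x" "coord (mirror \<nu> *v x) = \<nu> * cnj (coord x)"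
  by (simp_all add: coord_def mirror_def power2_eq_square mult_ac)

lemma coord_eq_iff: "coord x = coord y \<longleftrightarrow> x = y"
proof -
  have "\<mu> \<noteq> 0" using norm_\<mu> by auto
  then show ?thesis by (simp add: coord_def to_complex_eq_iff)
qed

lemma coord_surj: "\<exists>x. coord x = z"
  by (rule exI[of _ "of_complex (cnj \<mu> * z)"]) (simp add: coord_def)

lemma coord_0 [simp]: "coord 0 = 0"
  by (simp add: coord_def)

lemma coord_eq_0_iff [simp]: "coord x = 0 \<longleftrightarrow> x = 0"
  using coord_eq_iff[of x 0] by simp

lemma mirror_mult: "mirror a ** mirror b = rotation (a * cnj b)"
  "rotation a ** mirror b = mirror (a * b)"
  by (simp_all add: mirror_def composition power2_eq_square mult_ac)

lemma rotation_neq_mirror: "\<nu> \<noteq> 0 \<Longrightarrow> rotation \<eta> \<noteq> mirror \<nu>"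
  unfolding mirror_def using norm_\<mu> by (intro rotation_neq_reflection) auto

lemma root_in_W:
  assumes "\<eta> ^ m = 1" shows "rotation \<eta> \<in> W" "mirror \<eta> \<in> W"
proof -
  show "rotation \<eta> \<in> W"
    using rotation_in_W assms root_norm by blast
  have "norm ((cnj \<mu>)\<^sup>2 * \<eta>) = 1"
    using norm_\<mu> root_norm[OF assms] by (simp add: norm_mult norm_power)
  moreover have "\<mu>\<^sup>2 * ((cnj \<mu>)\<^sup>2 * \<eta>) = \<eta>"
    by (simp add: power2_eq_square mult_ac)
  ultimately show "mirror \<eta> \<in> W"
    unfolding mirror_def using reflection_in_W assms by metis
qed

lemma W_cases:
  assumes "w \<in> W"
  obtains (rotation) \<eta> where "\<eta> ^ m = 1" "w = rotation \<eta>"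
    | (mirror) \<eta> where "\<eta> ^ m = 1" "w = mirror \<eta>"
proof -
  from orthogonal_matrix_cases[OF subgroup_orthogonal_groupD(1)[OF subgroup assms]]
  obtain \<eta> where \<eta>: "norm \<eta> = 1" "w = rotation \<eta> \<or> w = reflection \<eta>" .
  from \<eta>(2) show ?thesis
  proof
    assume "w = rotation \<eta>"
    then show ?thesis
      using rotation rotation_in_W[OF \<eta>(1)] assms by blast
  next
    assume w: "w = reflection \<eta>"
    then have "(\<mu>\<^sup>2 * \<eta>) ^ m = 1"
      using reflection_in_W[OF \<eta>(1)] assms by blast
    moreover have "w = mirror (\<mu>\<^sup>2 * \<eta>)"
      by (simp add: w mirror_def power2_eq_square mult_ac)
    ultimately show ?thesis
      by (rule mirror)
  qed
qed

lemma \<omega>_power_eq_1_iff: "\<omega> ^ n = 1 \<longleftrightarrow> m dvd n"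
proof -
  have "\<omega> ^ n = exp (2 * of_real pi * \<i> * of_nat n / of_nat m)"
    by (simp add: cis_conv_exp mult_ac flip: exp_of_nat_mult)
  then show ?thesis
    using complex_root_unity_eq_1[of m n] m_pos by simp
qed

lemma \<omega>_root [simp]: "\<omega> ^ m = 1"
  by (simp add: \<omega>_power_eq_1_iff)

lemma \<omega>_neq_1: "\<omega> \<noteq> 1"
  using \<omega>_power_eq_1_iff[of 1] m_ge_3 by simp

lemma c_in_W: "c \<in> W"
  unfolding c_eq by (intro root_in_W root_cnj) simp

lemma ord_c: "group.ord orthogonal_group c = m"
proof -
  interpret group "orthogonal_group :: (real^'n^'n) monoid"
    by (rule group_orthogonal_group)
  have pow: "c [^]\<^bsub>orthogonal_group\<^esub> k = rotation (cnj (\<omega> ^ k))" for k :: nat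
  proof (induction k)
    case (Suc k)
    then show ?case
      by (simp add: nat_pow_Suc c_eq composition mult.commute)
  qed (simp add: rotation_1)
  have "c [^]\<^bsub>orthogonal_group\<^esub> k = \<one>\<^bsub>orthogonal_group\<^esub> \<longleftrightarrow> m dvd k" for k :: nat
  proof -
    have "c [^]\<^bsub>orthogonal_group\<^esub> k = \<one>\<^bsub>orthogonal_group\<^esub> \<longleftrightarrow> cnj (\<omega> ^ k) = 1"
      unfolding pow using rotation_eq_iff[of _ 1] by (simp add: rotation_1)
    also have "\<dots> \<longleftrightarrow> \<omega> ^ k = 1"
      by (metis complex_cnj_cnj complex_cnj_one)
    finally show ?thesis
      by (simp only: \<omega>_power_eq_1_iff)
  qed
  moreover have "c \<in> carrier orthogonal_group"
    using subgroup_orthogonal_groupD(1)[OF subgroup c_in_W] by simp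
  ultimately show ?thesis
    using pow_eq_id by (metis dvd_antisym dvd_refl)
qed

section \<open>Noncrossing flats of dihedral groups\<close>

text \<open>A square root \<open>s\<close> of \<open>cnj \<zeta>\<close> has norm 1 and satisfies
  \<open>cnj s = \<zeta> * s\<close>.\<close>

lemma flat_nonzero_vector:
  assumes "\<zeta> ^ m = 1"
  obtains x where "x \<in> flat \<zeta>" "x \<noteq> 0"
proof -
  define s where "s = csqrt (cnj \<zeta>)"
  have s2: "s * s = cnj \<zeta>"
    unfolding s_def by (metis power2_csqrt power2_eq_square)
  then have "norm s * norm s = 1"
    using root_norm[OF assms] by (metis complex_mod_cnj norm_mult)
  then have "norm s = 1"
    using power2_eq_imp_eq[of "norm s" 1] by (simp add: power2_eq_square)
  then have s: "s * cnj s = 1"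
    by (simp add: complex_norm_square[symmetric])
  have "cnj s = \<zeta> * cnj \<zeta> * cnj s"
    by (simp add: root_cnj[OF assms])
  also have "\<dots> = \<zeta> * s * (s * cnj s)"
    by (simp add: mult_ac flip: s2)
  finally have "cnj s = \<zeta> * s"
    using s by simp
  moreover obtain x where x: "coord x = s"
    using coord_surj by blast
  moreover have "x \<noteq> 0"
    using x s by auto
  ultimately show ?thesis
    using that[of x] by (simp add: flat_def)
qed

lemma flat_eq_iff:
  assumes "\<zeta> ^ m = 1" shows "flat \<zeta> = flat \<zeta>' \<longleftrightarrow> \<zeta> = \<zeta>'"
proof
  assume *: "flat \<zeta> = flat \<zeta>'"
  obtain x where "x \<in> flat \<zeta>" "x \<noteq> 0"
    using flat_nonzero_vector[OF assms] .
  moreover from this * have "x \<in> flat \<zeta>'"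
    by simp
  ultimately have "\<zeta> * coord x = \<zeta>' * coord x" "coord x \<noteq> 0"
    by (auto simp: flat_def)
  then show "\<zeta> = \<zeta>'" by simp
qed simp

lemma flat_neq_0: "\<zeta> ^ m = 1 \<Longrightarrow> flat \<zeta> \<noteq> {0}"
  using flat_nonzero_vector by (metis singletonD)

lemma flat_neq_UNIV: "flat \<zeta> \<noteq> UNIV"
proof
  assume *: "flat \<zeta> = UNIV"
  obtain x y where "coord x = 1" "coord y = \<i>"
    using coord_surj by metis
  moreover have "x \<in> flat \<zeta>" "y \<in> flat \<zeta>"
    using * by auto
  ultimately show False
    by (auto simp: flat_def complex_eq_iff)
qed

lemma UNIV_neq_0: "UNIV \<noteq> {0 :: real^'n}"
proof
  assume *: "UNIV = {0 :: real^'n}"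
  obtain x where "coord x = 1"
    using coord_surj by blast
  then show False using * by (metis UNIV_I coord_0 singletonD zero_neq_one)
qed

lemma fixed_space_mirror:
  assumes "\<nu> ^ m = 1"
  shows "fixed_space (mirror \<nu>) = flat (cnj \<nu>)"
proof -
  have "\<nu> * cnj y = y \<longleftrightarrow> cnj y = cnj \<nu> * y" for y
    using root_cnj[OF assms] by (metis mult.assoc mult_1)
  then show ?thesis
    by (auto simp: fixed_space_def flat_def coord_mult simp flip: coord_eq_iff)
qed

lemma rotation_fixes_iff: "rotation \<eta> *v x = x \<longleftrightarrow> \<eta> = 1 \<or> x = 0"
  using coord_eq_iff[of "rotation \<eta> *v x" x] by (auto simp: coord_mult)

lemma fixed_space_rotation: "\<eta> \<noteq> 1 \<Longrightarrow> fixed_space (rotation \<eta>) = {0}"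
  by (simp add: fixed_space_def rotation_fixes_iff)

text \<open>Turning a nonzero vector by \<open>\<eta>\<close> multiplies the ratio of
  \<open>cnj (coord x)\<close> to \<open>coord x\<close> by \<open>(cnj \<eta>) ^ 2\<close>.\<close>

lemma rotation_flat:
  assumes "\<eta> ^ m = 1"
  shows "(*v) (rotation \<eta>) ` flat \<zeta> = flat ((cnj \<eta>)\<^sup>2 * \<zeta>)"
proof (intro equalityI subsetI)
  fix y assume "y \<in> (*v) (rotation \<eta>) ` flat \<zeta>"
  then obtain x where "y = rotation \<eta> *v x" "x \<in> flat \<zeta>" by blast
  then show "y \<in> flat ((cnj \<eta>)\<^sup>2 * \<zeta>)"
    using root_cnj[OF assms] by (simp add: flat_def coord_mult power2_eq_square mult_ac)
next
  fix y assume y: "y \<in> flat ((cnj \<eta>)\<^sup>2 * \<zeta>)"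
  define x where "x = rotation (cnj \<eta>) *v y"
  have "y = rotation \<eta> *v x"
    using root_cnj[OF assms] by (simp add: x_def coord_mult flip: coord_eq_iff mult.assoc)
  moreover have "x \<in> flat \<zeta>"
  proof -
    have "cnj (coord x) = \<eta> * ((cnj \<eta>)\<^sup>2 * \<zeta> * coord y)"
      using y by (simp add: x_def coord_mult flat_def)
    also have "\<dots> = (\<eta> * cnj \<eta>) * (\<zeta> * (cnj \<eta> * coord y))"
      by (simp add: power2_eq_square mult_ac)
    finally show ?thesis
      by (simp add: root_cnj[OF assms] flat_def x_def coord_mult)
  qed
  ultimately show "y \<in> (*v) (rotation \<eta>) ` flat \<zeta>" by blast
qed

lemma rotation_image:
  assumes "\<eta> ^ m = 1"
  shows "range ((*v) (rotation \<eta>)) = UNIV" "(*v) (rotation \<eta>) ` {0} = {0}"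
proof -
  have "y = rotation \<eta> *v (rotation (cnj \<eta>) *v y)" for y
    using root_cnj[OF assms] by (simp add: coord_mult flip: coord_eq_iff mult.assoc)
  then show "range ((*v) (rotation \<eta>)) = UNIV" by blast
qed simp

lemma stabilizer_UNIV:
  "\<eta> ^ m = 1 \<Longrightarrow> rotation \<eta> \<in> pointwise_stabilizer W UNIV \<longleftrightarrow> \<eta> = 1"
  "\<eta> ^ m = 1 \<Longrightarrow> mirror \<eta> \<notin> pointwise_stabilizer W UNIV"
proof -
  have iff: "w \<in> pointwise_stabilizer W UNIV \<longleftrightarrow> w = rotation 1" if "w \<in> W" for w
    using that by (auto simp: pointwise_stabilizer_def rotation_1 matrix_eq)
  show "rotation \<eta> \<in> pointwise_stabilizer W UNIV \<longleftrightarrow> \<eta> = 1" if "\<eta> ^ m = 1"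
    using iff root_in_W[OF that] by (simp add: rotation_eq_iff)
  show "mirror \<eta> \<notin> pointwise_stabilizer W UNIV" if "\<eta> ^ m = 1"
    using iff root_in_W[OF that] rotation_neq_mirror root_cnj[OF that] by metis
qed

text \<open>On the flat, a rotation acts on \<open>coord\<close> as the scalar \<open>\<eta>\<close>
  and a mirror as the scalar \<open>\<eta> * \<zeta>\<close>, so one nonzero vector decides whether
  the flat is fixed pointwise.\<close>

lemma stabilizer_flat:
  assumes "\<zeta> ^ m = 1" "\<eta> ^ m = 1"
  shows "rotation \<eta> \<in> pointwise_stabilizer W (flat \<zeta>) \<longleftrightarrow> \<eta> = 1"
    and "mirror \<eta> \<in> pointwise_stabilizer W (flat \<zeta>) \<longleftrightarrow> \<eta> * \<zeta> = 1"
proof -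
  obtain x where x: "x \<in> flat \<zeta>" "x \<noteq> 0"
    using flat_nonzero_vector[OF assms(1)] .
  have stab: "w \<in> pointwise_stabilizer W (flat \<zeta>) \<longleftrightarrow> w *v x = x"
    if "w \<in> W" "\<And>y. y \<in> flat \<zeta> \<Longrightarrow> w *v y = y \<longleftrightarrow> P \<or> y = 0" for w P
    using that x by (auto simp: pointwise_stabilizer_def)
  show "rotation \<eta> \<in> pointwise_stabilizer W (flat \<zeta>) \<longleftrightarrow> \<eta> = 1"
    using stab[OF root_in_W(1)[OF assms(2)] rotation_fixes_iff] x(2)
    by (simp add: rotation_fixes_iff)
  have "mirror \<eta> *v y = y \<longleftrightarrow> \<eta> * \<zeta> = 1 \<or> y = 0" if "y \<in> flat \<zeta>" for y
  proof -
    have "coord (mirror \<eta> *v y) = \<eta> * \<zeta> * coord y"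
      using that by (simp add: coord_mult flat_def mult.assoc)
    then show ?thesis
      using coord_eq_iff[of "mirror \<eta> *v y" y] by auto
  qed
  with stab[OF root_in_W(2)[OF assms(2)] this] x
  show "mirror \<eta> \<in> pointwise_stabilizer W (flat \<zeta>) \<longleftrightarrow> \<eta> * \<zeta> = 1" by simp
qed

lemma reflections_eq_mirrors: "reflections W = mirror ` {\<nu>. \<nu> ^ m = 1}"
proof (intro equalityI subsetI)
  fix t assume t: "t \<in> reflections W"
  then obtain \<eta> where \<eta>: "norm \<eta> = 1" "t = reflection \<eta>" "t \<in> W"
    unfolding reflections_eq by blast
  from \<open>t \<in> W\<close> show "t \<in> mirror ` {\<nu>. \<nu> ^ m = 1}"
  proof (cases rule: W_cases)
    case (rotation \<eta>')
    then show ?thesis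
      using \<eta> rotation_neq_reflection[of \<eta> \<eta>'] by force
  qed blast
next
  fix t assume "t \<in> mirror ` {\<nu>. \<nu> ^ m = 1}"
  then obtain \<nu> where \<nu>: "\<nu> ^ m = 1" "t = mirror \<nu>" by blast
  have "norm ((cnj \<mu>)\<^sup>2 * \<nu>) = 1"
    using norm_\<mu> root_norm[OF \<nu>(1)] by (simp add: norm_mult norm_power)
  then show "t \<in> reflections W"
    unfolding reflections_eq using root_in_W[OF \<nu>(1)] \<nu>(2) mirror_def by blast
qed

lemma reflection_length_mirror:
  assumes "\<nu> ^ m = 1" shows "reflection_length W (mirror \<nu>) = 1"
proof -
  have t: "set [mirror \<nu>] \<subseteq> reflections W" "mirror \<nu> = matrix_prod [mirror \<nu>]"
    using assms by (auto simp: reflections_eq_mirrors)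
  then have "reflection_length W (mirror \<nu>) \<le> 1"
    using reflection_length_le[of "[mirror \<nu>]" W] by simp
  moreover have "reflection_length W (mirror \<nu>) \<noteq> 0"
  proof
    assume "reflection_length W (mirror \<nu>) = 0"
    with reflection_lengthE[OF t] have "mirror \<nu> = mat 1"
      by (metis length_0_conv matrix_prod_simps(1))
    then show False
      using rotation_neq_mirror[of \<nu> 1] root_cnj[OF assms] by (simp add: rotation_1)
  qed
  ultimately show ?thesis by linarith
qed

text \<open>It is \<open>mirror \<eta> ** mirror 1\<close>, but neither the identity nor a single
  mirror.\<close>

lemma reflection_length_rotation:
  assumes "\<eta> ^ m = 1" "\<eta> \<noteq> 1" shows "reflection_length W (rotation \<eta>) = 2"
proof -
  have t: "set [mirror \<eta>, mirror 1] \<subseteq> reflections W"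
      "rotation \<eta> = matrix_prod [mirror \<eta>, mirror 1]"
    using assms by (auto simp: reflections_eq_mirrors mirror_mult)
  then have "reflection_length W (rotation \<eta>) \<le> 2"
    using reflection_length_le[of "[mirror \<eta>, mirror 1]" W] by simp
  moreover obtain ts where ts: "length ts = reflection_length W (rotation \<eta>)"
    "set ts \<subseteq> reflections W" "rotation \<eta> = matrix_prod ts"
    using reflection_lengthE[OF t] .
  have "length ts \<noteq> 0"
    using ts(3) assms(2) by (auto simp: rotation_eq_iff simp flip: rotation_1)
  moreover have "length ts \<noteq> 1"
  proof
    assume "length ts = 1"
    then obtain s where "ts = [s]"
      by (auto simp: length_Suc_conv)
    then obtain \<nu> where "\<nu> ^ m = 1" "rotation \<eta> = mirror \<nu>"
      using ts by (auto simp: reflections_eq_mirrors)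
    then show False
      using rotation_neq_mirror root_cnj by blast
  qed
  ultimately show ?thesis
    using ts(1) by linarith
qed

text \<open>As \<open>c\<close> has length 2, a rotation other than the identity and
  \<open>c\<close> would give total length 4, while each mirror is below \<open>c\<close> because
  its product with \<open>c\<close> is again a mirror.\<close>

lemma noncrossing_flats_eq: "noncrossing_flats W c = {UNIV, {0}} \<union> flat ` {\<zeta>. \<zeta> ^ m = 1}"
proof -
  have cnj_\<omega>: "cnj \<omega> ^ m = 1" "cnj \<omega> \<noteq> 1"
    using root_cnj(3)[OF \<omega>_root] \<omega>_neq_1 by (auto simp: complex_cnj_cancel_iff[of _ 1, simplified])
  have len_c: "reflection_length W c = 2"
    unfolding c_eq using cnj_\<omega> by (rule reflection_length_rotation)
  have orth: "orthogonal_matrix w" if "w \<in> W" for w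
    using subgroup_orthogonal_groupD(1)[OF subgroup that] .
  have "{w \<in> W. absolute_le W w c} = {mat 1, c} \<union> mirror ` {\<nu>. \<nu> ^ m = 1}"
  proof (intro equalityI subsetI)
    fix w assume "w \<in> {w \<in> W. absolute_le W w c}"
    then have w: "w \<in> W" "2 = reflection_length W w + reflection_length W (transpose w ** c)"
      using inv_orthogonal_group[OF orth] by (auto simp: absolute_le_def len_c)
    from w(1) show "w \<in> {mat 1, c} \<union> mirror ` {\<nu>. \<nu> ^ m = 1}"
    proof (cases rule: W_cases)
      case (rotation \<eta>)
      have "\<eta> = 1 \<or> cnj \<eta> * cnj \<omega> = 1"
      proof (rule ccontr)
        assume "\<not> (\<eta> = 1 \<or> cnj \<eta> * cnj \<omega> = 1)"
        moreover have "(cnj \<eta> * cnj \<omega>) ^ m = 1"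
          using root_cnj(3)[OF rotation(1)] cnj_\<omega> by (simp add: power_mult_distrib)
        ultimately show False
          using w(2) rotation
          by (simp add: reflection_length_rotation transpose_rotation composition c_eq)
      qed
      then have "\<eta> = 1 \<or> \<eta> = cnj \<omega>"
        using root_cnj[OF rotation(1)] by (metis mult.assoc mult_1 mult_1_right)
      then show ?thesis
        using rotation(2) rotation_1 c_eq by auto
    qed blast
  next
    fix w assume "w \<in> {mat 1, c} \<union> mirror ` {\<nu>. \<nu> ^ m = 1}"
    then consider "w = mat 1" | "w = c" | \<nu> where "\<nu> ^ m = 1" "w = mirror \<nu>"
      by blast
    then show "w \<in> {w \<in> W. absolute_le W w c}"
    proof cases
      case 1
      then show ?thesis
        using absolute_le_mat_1 subgroup_orthogonal_groupD(3)[OF subgroup] by blast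
    next
      case 2
      then show ?thesis
        using absolute_le_refl orth c_in_W by blast
    next
      case 3
      have "w ** c = mirror (\<nu> * \<omega>)"
        by (simp add: 3 mirror_def c_eq composition mult.assoc)
      moreover have "(\<nu> * \<omega>) ^ m = 1"
        using 3 by (simp add: power_mult_distrib)
      moreover have "transpose w = w"
        by (simp add: 3 mirror_def transpose_reflection)
      ultimately have "absolute_le W w c"
        using inv_orthogonal_group[OF orth] root_in_W[OF 3(1)]
        by (simp add: absolute_le_def len_c 3 reflection_length_mirror)
      then show ?thesis
        using 3 root_in_W by blast
    qed
  qed
  moreover have "fixed_space ` mirror ` {\<nu>. \<nu> ^ m = 1} = flat ` {\<zeta>. \<zeta> ^ m = 1}"
  proof -
    have "cnj ` {\<nu>. \<nu> ^ m = 1} = {\<zeta>. \<zeta> ^ m = 1}"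
      using root_cnj(3) by (auto intro!: image_eqI[of _ cnj, OF complex_cnj_cnj[symmetric]])
    moreover have "fixed_space ` mirror ` {\<nu>. \<nu> ^ m = 1} = flat ` cnj ` {\<nu>. \<nu> ^ m = 1}"
      unfolding image_image by (intro image_cong refl) (simp add: fixed_space_mirror)
    ultimately show ?thesis by simp
  qed
  moreover have "fixed_space c = {0}"
    unfolding c_eq using cnj_\<omega> by (intro fixed_space_rotation)
  ultimately show ?thesis
    by (simp add: noncrossing_flats_def image_Un)
qed

section \<open>Base points of the noncrossing flats\<close>

text \<open>The base points are the origin for \<open>{0}\<close>, a point of the first axis for
  \<open>UNIV\<close>, and a point with ratio \<open>\<zeta>\<close> for
  \<open>flat \<zeta>\<close>. The scale \<open>\<kappa> \<zeta>\<close> depends on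
  \<open>\<zeta>\<close> only through \<open>D \<zeta>\<close>, which makes the choice compatible
  with \<open>c\<close>.\<close>

lemma equivariant_bijection_solutions:
  assumes "dihedral_hsop m k \<alpha> \<beta> \<gamma>"
  shows "\<exists>F. equivariant_bijection W c m
    ((\<lambda>(a, b). point a b) ` dihedral_hsop.solutions m k \<alpha> \<beta> \<gamma>) F"
proof -
  interpret E: dihedral_hsop m k \<alpha> \<beta> \<gamma> by fact
  obtain r :: "complex \<Rightarrow> complex" where r: "\<And>a. r a ^ m = a"
    by (rule nth_root_function[OF m_pos]) blast
  define a0 where "a0 = r (1 / \<alpha>)"
  define \<kappa> where "\<kappa> \<zeta> = r (1 / E.D \<zeta>)" for \<zeta>
  define q where "q X = (if X = UNIV then point a0 0 else if X = {0} then point 0 0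
    else let \<zeta> = THE \<zeta>. \<zeta> ^ m = 1 \<and> X = flat \<zeta> in point (\<kappa> \<zeta>) (\<kappa> \<zeta> * \<zeta>))" for X
  have a0: "a0 ^ m = 1 / \<alpha>" "a0 \<noteq> 0"
    using r[of "1 / \<alpha>"] E.\<alpha>_nonzero m_pos by (auto simp: a0_def zero_power)
  have \<kappa>: "\<kappa> \<zeta> ^ m = 1 / E.D \<zeta>" "\<kappa> \<zeta> \<noteq> 0" if "\<zeta> ^ m = 1" for \<zeta>
    using r[of "1 / E.D \<zeta>"] E.D_nonzero[OF that] m_pos by (auto simp: \<kappa>_def zero_power)
  have \<kappa>_square: "\<kappa> (\<zeta> * \<eta>\<^sup>2) = \<kappa> \<zeta>" if "\<eta> ^ m = 1" for \<zeta> \<eta>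
    using E.D_mult_square[OF that] by (simp add: \<kappa>_def)
  have \<kappa>_cnj: "\<kappa> (cnj \<zeta>) = \<kappa> \<zeta>" if "\<zeta> ^ m = 1" for \<zeta>
  proof -
    have "cnj \<zeta> = inverse \<zeta>"
      using root_cnj[OF that] by (metis inverse_unique)
    then show ?thesis
      using E.D_inverse[OF that] by (simp add: \<kappa>_def)
  qed
  have q_UNIV: "q UNIV = point a0 0"
    by (simp add: q_def)
  have q_0: "q {0} = point 0 0"
    using UNIV_neq_0 by (simp add: q_def)
  have q_flat: "q (flat \<zeta>) = point (\<kappa> \<zeta>) (\<kappa> \<zeta> * \<zeta>)" if "\<zeta> ^ m = 1" for \<zeta>
  proof -
    have "(THE \<zeta>'. \<zeta>' ^ m = 1 \<and> flat \<zeta> = flat \<zeta>') = \<zeta>"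
      using that flat_eq_iff[OF that] by (intro the_equality) metis+
    then show ?thesis
      using flat_neq_UNIV flat_neq_0[OF that] by (simp add: q_def)
  qed
  have cnj_\<omega>: "cnj \<omega> ^ m = 1"
    using root_cnj(3)[OF \<omega>_root] .
  have flat_image: "(*v) (rotation \<eta>) ` X \<in> noncrossing_flats W c"
    if \<eta>: "\<eta> ^ m = 1" and X: "X \<in> noncrossing_flats W c" for \<eta> X
  proof -
    have "((cnj \<eta>)\<^sup>2 * \<zeta>) ^ m = 1" if "\<zeta> ^ m = 1" for \<zeta>
      using that root_cnj(3)[OF \<eta>] by (simp only: power2_eq_square power_mult_distrib mult_1)
    then show ?thesis
      using X rotation_image[OF \<eta>] rotation_flat[OF \<eta>] unfolding noncrossing_flats_eq by auto
  qed
  show ?thesis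
  proof (rule equivariant_bijection_from_base_points[OF subgroup c_in_W, where q = q])
    show "(*v) c ` X \<in> noncrossing_flats W c" "(*v) (transpose c) ` X \<in> noncrossing_flats W c"
      if "X \<in> noncrossing_flats W c" for X
      using flat_image[OF _ that] cnj_\<omega> \<omega>_root
      unfolding c_eq transpose_rotation complex_cnj_cnj by blast+
    show "q ((*v) c ` X) = V_action m c 1 (q X)" if X: "X \<in> noncrossing_flats W c" for X
    proof -
      \<comment> \<open>The scalar \<open>\<omega>\<close> cancels \<open>c\<close> on the first
        coordinate and doubles its effect on the second, just as \<open>c\<close> moves
        \<open>flat \<zeta>\<close> to \<open>flat (\<zeta> * \<omega>\<^sup>2)\<close>.\<close>
      have act: "V_action m c 1 (point a b) = point a (b * \<omega>\<^sup>2)" for a b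
      proof -
        have "V_action m c 1 (point a b) = point (\<omega> * (cnj \<omega> * a)) (\<omega> * (\<omega> * b))"
          unfolding V_action_def c_eq rotation_point scale_point by simp
        also have "\<omega> * (cnj \<omega> * a) = a"
          using root_cnj(1)[OF \<omega>_root] by (metis mult.assoc mult_1)
        also have "\<omega> * (\<omega> * b) = b * \<omega>\<^sup>2"
          by (simp only: power2_eq_square mult_ac)
        finally show ?thesis .
      qed
      consider "X = UNIV" | "X = {0}" | \<zeta> where "\<zeta> ^ m = 1" "X = flat \<zeta>"
        using X unfolding noncrossing_flats_eq by blast
      then show ?thesis
      proof cases
        case 1
        then show ?thesis
          unfolding 1 q_UNIV act using rotation_image(1)[OF cnj_\<omega>, folded c_eq] by (simp add: q_UNIV)
      next
        case 2
        then show ?thesis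
          unfolding 2 q_0 act by (simp add: q_0)
      next
        case 3
        have "(\<zeta> * \<omega>\<^sup>2) ^ m = 1"
          using 3(1) by (simp only: power2_eq_square power_mult_distrib mult_1 \<omega>_root)
        moreover have "(*v) c ` X = flat (\<zeta> * \<omega>\<^sup>2)"
          unfolding c_eq 3(2) rotation_flat[OF cnj_\<omega>] by (simp add: mult.commute)
        ultimately show ?thesis
          unfolding 3(2) q_flat[OF 3(1)] act
          using \<kappa>_square[OF \<omega>_root] by (simp add: q_flat mult.assoc 3(2))
      qed
    qed
    \<comment> \<open>Elements of \<open>W\<close> preserve the number of nonzero coordinates, which
      is 0, 1 and 2 for \<open>{0}\<close>, \<open>UNIV\<close> and the mirrors. Only two mirrors
      require an explicit argument.\<close>
    show "complexify w *v q X = q X' \<longleftrightarrow> X = X' \<and> w \<in> pointwise_stabilizer W X"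
      if w: "w \<in> W" and X: "X \<in> noncrossing_flats W c" and X': "X' \<in> noncrossing_flats W c" for w X X'
    proof -
      have neqs: "UNIV \<noteq> {0 :: real^'n}" "{0 :: real^'n} \<noteq> UNIV"
        using UNIV_neq_0 by auto
      have flat_neqs: "flat \<zeta> \<noteq> UNIV" "UNIV \<noteq> flat \<zeta>" "flat \<zeta> \<noteq> {0}" "{0} \<noteq> flat \<zeta>" "\<zeta> \<noteq> 0"
        if "\<zeta> ^ m = 1" for \<zeta>
        using flat_neq_UNIV flat_neq_0[OF that] root_cnj(4)[OF that] by auto
      have stab_0: "w \<in> pointwise_stabilizer W {0}"
        using w by (simp add: pointwise_stabilizer_def)
      consider (U) "X = UNIV" | (Z) "X = {0}" | (L) \<zeta> where "\<zeta> ^ m = 1" "X = flat \<zeta>"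
        using X unfolding noncrossing_flats_eq by blast
      note X_cases = this
      consider (U) "X' = UNIV" | (Z) "X' = {0}" | (L) \<zeta> where "\<zeta> ^ m = 1" "X' = flat \<zeta>"
        using X' unfolding noncrossing_flats_eq by blast
      note X'_cases = this
      from w show ?thesis
      proof (cases rule: W_cases)
        case (rotation \<eta>)
        note act = rotation_point[of \<eta>, folded rotation(2)]
        have stab_U: "w \<in> pointwise_stabilizer W UNIV \<longleftrightarrow> \<eta> = 1"
          using stabilizer_UNIV(1) rotation by blast
        have \<eta>: "\<eta> \<noteq> 0" "cnj \<eta> \<noteq> 0"
          using root_cnj(4)[OF rotation(1)] by auto
        show ?thesis
        proof (cases rule: X_cases)
          case U
          show ?thesis
            by (cases rule: X'_cases)
              (use a0 \<kappa> neqs flat_neqs \<eta> in \<open>auto simp: U q_UNIV q_0 q_flat act point_eq_iff stab_U\<close>)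
        next
          case Z
          show ?thesis
            by (cases rule: X'_cases)
              (use a0 \<kappa> neqs flat_neqs stab_0 in \<open>auto simp: Z q_UNIV q_0 q_flat act point_eq_iff\<close>)
        next
          case (L \<zeta>)
          note L1 = this
          show ?thesis
          proof (cases rule: X'_cases)
            case (L \<zeta>')
            have "complexify w *v q X = q X' \<longleftrightarrow> \<eta> * \<kappa> \<zeta> = \<kappa> \<zeta>' \<and> cnj \<eta> * (\<kappa> \<zeta> * \<zeta>) = \<kappa> \<zeta>' * \<zeta>'"
              by (simp add: L1 L q_flat act point_eq_iff)
            also have "\<dots> \<longleftrightarrow> \<zeta> = \<zeta>' \<and> \<eta> = 1"
            proof (intro iffI conjI)
              assume *: "\<eta> * \<kappa> \<zeta> = \<kappa> \<zeta>' \<and> cnj \<eta> * (\<kappa> \<zeta> * \<zeta>) = \<kappa> \<zeta>' * \<zeta>'"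
              then have "\<kappa> \<zeta> * (cnj \<eta> * \<zeta>) = \<kappa> \<zeta> * (\<eta> * \<zeta>')"
                by (metis mult.assoc mult.commute)
              then have "cnj \<eta> * \<zeta> = \<eta> * \<zeta>'"
                using \<kappa>(2)[OF L1(1)] by simp
              then have "cnj \<eta> * (cnj \<eta> * \<zeta>) = cnj \<eta> * \<eta> * \<zeta>'"
                by (simp add: mult.assoc)
              \<comment> \<open>The ratios differ by a square, so the scales agree and the first
                coordinate then forces \<open>\<eta> = 1\<close>.\<close>
              then have \<zeta>': "\<zeta>' = \<zeta> * (cnj \<eta>)\<^sup>2"
                by (simp add: root_cnj[OF rotation(1)] power2_eq_square mult_ac)
              then have "\<kappa> \<zeta>' = \<kappa> \<zeta>"
                using \<kappa>_square root_cnj(3)[OF rotation(1)] by blast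
              then show "\<eta> = 1"
                using * \<kappa>(2)[OF L1(1)] by simp
              then show "\<zeta> = \<zeta>'"
                using \<zeta>' by simp
            qed auto
            finally show ?thesis
              using stabilizer_flat(1)[OF L1(1) rotation(1)] flat_eq_iff[OF L1(1)]
              by (simp add: L1 L rotation(2))
          qed (use a0 \<kappa> neqs flat_neqs \<eta> L1 in \<open>auto simp: q_UNIV q_0 q_flat act point_eq_iff\<close>)
        qed
      next
        case (mirror \<eta>)
        note act = mirror_point[of \<eta>, folded mirror(2)]
        have stab_U: "w \<notin> pointwise_stabilizer W UNIV"
          using stabilizer_UNIV(2) mirror by blast
        have \<eta>: "\<eta> \<noteq> 0" "cnj \<eta> \<noteq> 0"
          using root_cnj(4)[OF mirror(1)] by auto
        show ?thesis
        proof (cases rule: X_cases)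
          case U
          show ?thesis
            by (cases rule: X'_cases)
              (use a0 \<kappa> neqs flat_neqs \<eta> in \<open>auto simp: U q_UNIV q_0 q_flat act point_eq_iff stab_U\<close>)
        next
          case Z
          show ?thesis
            by (cases rule: X'_cases)
              (use a0 \<kappa> neqs flat_neqs stab_0 in \<open>auto simp: Z q_UNIV q_0 q_flat act point_eq_iff\<close>)
        next
          case (L \<zeta>)
          note L1 = this
          show ?thesis
          proof (cases rule: X'_cases)
            case (L \<zeta>')
            have "complexify w *v q X = q X' \<longleftrightarrow> \<eta> * (\<kappa> \<zeta> * \<zeta>) = \<kappa> \<zeta>' \<and> cnj \<eta> * \<kappa> \<zeta> = \<kappa> \<zeta>' * \<zeta>'"
              by (simp add: L1 L q_flat act point_eq_iff)
            also have "\<dots> \<longleftrightarrow> \<zeta> = \<zeta>' \<and> \<eta> * \<zeta> = 1"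
            proof (intro iffI conjI)
              assume *: "\<eta> * (\<kappa> \<zeta> * \<zeta>) = \<kappa> \<zeta>' \<and> cnj \<eta> * \<kappa> \<zeta> = \<kappa> \<zeta>' * \<zeta>'"
              then have "\<kappa> \<zeta> * cnj \<eta> = \<kappa> \<zeta> * (\<eta> * \<zeta> * \<zeta>')"
                by (metis mult.assoc mult.commute)
              then have **: "cnj \<eta> = \<eta> * \<zeta> * \<zeta>'"
                using \<kappa>(2)[OF L1(1)] by simp
              \<comment> \<open>Inserting two factors equal to 1 solves for \<open>\<zeta>'\<close>,
                which is \<open>cnj \<zeta>\<close> times a square; \<open>\<kappa>\<close> is blind
                to both changes.\<close>
              have "\<zeta>' = (cnj \<eta> * \<eta>) * (cnj \<zeta> * \<zeta>) * \<zeta>'"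
                by (simp add: root_cnj[OF mirror(1)] root_cnj[OF L1(1)])
              also have "\<dots> = cnj \<eta> * cnj \<zeta> * (\<eta> * \<zeta> * \<zeta>')"
                by (simp add: mult_ac)
              also have "\<dots> = cnj \<zeta> * (cnj \<eta>)\<^sup>2"
                unfolding **[symmetric] by (simp only: power2_eq_square mult_ac)
              finally have \<zeta>': "\<zeta>' = cnj \<zeta> * (cnj \<eta>)\<^sup>2" .
              then have "\<kappa> \<zeta>' = \<kappa> \<zeta>"
                using \<kappa>_square root_cnj(3)[OF mirror(1)] \<kappa>_cnj[OF L1(1)] by metis
              then show 1: "\<eta> * \<zeta> = 1"
                using * \<kappa>(2)[OF L1(1)] by (simp add: mult_ac)
              then have "cnj \<eta> = \<zeta>'"
                using ** by simp
              moreover have "cnj \<eta> = \<zeta>"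
                using 1 root_cnj[OF mirror(1)] by (metis mult.assoc mult_1 mult_1_right)
              ultimately show "\<zeta> = \<zeta>'" by simp
            next
              assume *: "\<zeta> = \<zeta>' \<and> \<eta> * \<zeta> = 1"
              then have "cnj \<eta> = \<zeta>"
                using root_cnj[OF mirror(1)] by (metis mult.assoc mult_1 mult_1_right)
              then show "\<eta> * (\<kappa> \<zeta> * \<zeta>) = \<kappa> \<zeta>'" "cnj \<eta> * \<kappa> \<zeta> = \<kappa> \<zeta>' * \<zeta>'"
                using * by (auto simp: mult_ac)
            qed
            finally show ?thesis
              using stabilizer_flat(2)[OF L1(1) mirror(1)] flat_eq_iff[OF L1(1)]
              by (simp add: L1 L mirror(2))
          qed (use a0 \<kappa> neqs flat_neqs \<eta> L1 in \<open>auto simp: q_UNIV q_0 q_flat act point_eq_iff\<close>)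
        qed
      qed
    qed
    show "(\<lambda>(a, b). point a b) ` E.solutions =
        {complexify w *v q X |w X. w \<in> W \<and> X \<in> noncrossing_flats W c}" (is "?Z = ?O")
    proof (intro equalityI subsetI)
      have flats: "UNIV \<in> noncrossing_flats W c" "{0} \<in> noncrossing_flats W c"
        "\<zeta> ^ m = 1 \<Longrightarrow> flat \<zeta> \<in> noncrossing_flats W c" for \<zeta>
        unfolding noncrossing_flats_eq by auto
      fix z assume "z \<in> ?Z"
      then consider "z = point 0 0" | a where "a ^ m = 1 / \<alpha>" "z = point a 0"
        | a where "a ^ m = 1 / \<alpha>" "z = point 0 a"
        | \<zeta> a where "\<zeta> ^ m = 1" "a ^ m = 1 / E.D \<zeta>" "z = point a (a * \<zeta>)"
        unfolding E.solutions_eq by auto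
      then show "z \<in> ?O"
      proof cases
        case 1
        have "z = complexify (rotation 1) *v q {0}"
          by (simp add: 1 q_0 rotation_point)
        then show ?thesis
          using flats root_in_W(1)[of 1] by auto
      next
        case 2
        have "(a / a0) ^ m = 1"
          using 2 a0 E.\<alpha>_nonzero by (simp add: power_divide)
        moreover have "z = complexify (rotation (a / a0)) *v q UNIV"
          using a0 by (simp add: 2 q_UNIV rotation_point)
        ultimately show ?thesis
          using flats root_in_W by blast
      next
        case 3
        have "(a / a0) ^ m = 1"
          using 3 a0 E.\<alpha>_nonzero by (simp add: power_divide)
        then have "cnj (a / a0) ^ m = 1"
          by (rule root_cnj(3))
        \<comment> \<open>The second axis is reached from the base point on the first one by
          mirrors, which conjugate the parameter.\<close>
        moreover have "z = complexify (mirror (cnj (a / a0))) *v q UNIV"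
          using a0 by (simp add: 3 q_UNIV mirror_point)
        ultimately show ?thesis
          using flats root_in_W by blast
      next
        case 4
        \<comment> \<open>A rotation also moves the flat: to arrive at ratio \<open>\<zeta>\<close>,
          it must start from the base point of \<open>flat (\<zeta> * \<eta>\<^sup>2)\<close>, whose
          scale is again \<open>\<kappa> \<zeta>\<close>.\<close>
        define \<eta> where "\<eta> = a / \<kappa> \<zeta>"
        have \<eta>: "\<eta> ^ m = 1" "a = \<eta> * \<kappa> \<zeta>"
          using 4 \<kappa> E.D_nonzero by (auto simp: \<eta>_def power_divide)
        have "(\<zeta> * \<eta>\<^sup>2) ^ m = 1"
          using \<eta>(1) 4(1) by (simp only: power2_eq_square power_mult_distrib mult_1)
        moreover from this have "z = complexify (rotation \<eta>) *v q (flat (\<zeta> * \<eta>\<^sup>2))"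
        proof -
          assume *: "(\<zeta> * \<eta>\<^sup>2) ^ m = 1"
          have "cnj \<eta> * (\<kappa> \<zeta> * (\<zeta> * \<eta>\<^sup>2)) = (cnj \<eta> * \<eta>) * (\<eta> * \<kappa> \<zeta> * \<zeta>)"
            by (simp add: power2_eq_square mult_ac)
          also have "\<dots> = a * \<zeta>"
            by (simp add: root_cnj[OF \<eta>(1)] \<eta>(2))
          finally show ?thesis
            by (simp only: 4(3) q_flat[OF *] \<kappa>_square[OF \<eta>(1)] rotation_point \<eta>(2)[symmetric])
        qed
        ultimately show ?thesis
          using flats root_in_W \<eta> by blast
      qed
    next
      \<comment> \<open>In the \<open>\<beta>\<close> term the factors \<open>\<eta> ^ k\<close> and
        \<open>cnj \<eta> ^ k\<close> cancel, and \<open>\<eta> ^ m = 1\<close> handles the other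
        two. Hence \<open>W\<close> preserves the solutions.\<close>
      have R_mult: "E.R (\<eta> * a) (cnj \<eta> * b) = \<eta> * E.R a b" if "\<eta> ^ m = 1" for \<eta> a b
      proof -
        have "(\<eta> * cnj \<eta>) ^ k = 1"
          by (simp add: root_cnj[OF that])
        then have "\<eta> ^ k * cnj \<eta> ^ k = 1"
          by (simp add: power_mult_distrib)
        then show ?thesis
          unfolding E.R_factor
          by (simp add: power_mult_distrib that root_cnj(3)[OF that] mult_ac)
      qed
      have R_mult': "E.R (cnj \<eta> * a) (\<eta> * b) = cnj \<eta> * E.R a b" if "\<eta> ^ m = 1" for \<eta> a b
        using R_mult[OF root_cnj(3)[OF that], of a b] by simp
      fix z assume "z \<in> ?O"
      then obtain w X where w: "w \<in> W" and X: "X \<in> noncrossing_flats W c"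
        and z: "z = complexify w *v q X" by blast
      have "(0, 0) \<in> E.solutions" "(a0, 0) \<in> E.solutions"
        using a0 unfolding E.solutions_eq by auto
      moreover have "(\<kappa> \<zeta>, \<kappa> \<zeta> * \<zeta>) \<in> E.solutions" if "\<zeta> ^ m = 1" for \<zeta>
        using that \<kappa>[OF that] unfolding E.solutions_eq
        by (intro UnI2 image_eqI[of _ _ "(\<zeta>, \<kappa> \<zeta>)"]) auto
      ultimately obtain a b where "q X = point a b" "(a, b) \<in> E.solutions"
        using X q_UNIV q_0 q_flat unfolding noncrossing_flats_eq by blast
      then have ab: "q X = point a b" "E.R a b = a" "E.R b a = b"
        by (auto simp: E.solutions_def)
      from w show "z \<in> ?Z"
      proof (cases rule: W_cases)
        case (rotation \<eta>)
        then have "z = point (\<eta> * a) (cnj \<eta> * b)"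
          by (simp add: z ab rotation_point)
        then show ?thesis
          using ab R_mult[OF rotation(1)] R_mult'[OF rotation(1)] by (auto simp: E.solutions_def)
      next
        case (mirror \<eta>)
        then have "z = point (\<eta> * b) (cnj \<eta> * a)"
          by (simp add: z ab mirror_point)
        then show ?thesis
          using ab R_mult[OF mirror(1)] R_mult'[OF mirror(1)] by (auto simp: E.solutions_def)
      qed
    qed
  qed
qed

section \<open>Admissible systems of parameters of dihedral groups\<close>

lemma point_nth:
  "point a b $ i = (cnj \<mu> * a + \<mu> * b) / 2"
  "point a b $ j = \<i> * (\<mu> * b - cnj \<mu> * a) / 2"
  using i_neq_j' by (simp_all add: point_def field_simps)

lemma span_u_v: "cfun.span {u, v} = dual_space"
proof (intro equalityI subsetI)
  fix f assume "f \<in> cfun.span {u, v}"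
  then obtain p q where "f = fun_scale p u + fun_scale q v"
    by (auto simp: cfun.span_insert cfun.span_singleton algebra_simps)
  then have "f = (\<lambda>z. \<Sum>k\<in>UNIV. (if k = i then p * \<mu> + q * cnj \<mu>
      else \<i> * (p * \<mu> - q * cnj \<mu>)) * z $ k)"
    using i_neq_j' by (auto simp: fun_scale_def u_def v_def sum_UNIV algebra_simps)
  then show "f \<in> dual_space"
    unfolding dual_space_iff
    by (rule exI[of _ "\<lambda>k. if k = i then p * \<mu> + q * cnj \<mu> else \<i> * (p * \<mu> - q * cnj \<mu>)"])
next
  fix f :: "complex^'n \<Rightarrow> complex" assume "f \<in> dual_space"
  then obtain a where a: "f = (\<lambda>z. a i * z $ i + a j * z $ j)"
    by (auto simp: dual_space_iff sum_UNIV)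
  have "f z = a i * point (u z) (v z) $ i + a j * point (u z) (v z) $ j" for z
    by (simp add: a)
  then have "f z = cnj \<mu> * (a i - \<i> * a j) / 2 * u z + \<mu> * (a i + \<i> * a j) / 2 * v z" for z
    unfolding point_nth by (simp add: algebra_simps add_divide_distrib diff_divide_distrib)
  then have "f = fun_scale (cnj \<mu> * (a i - \<i> * a j) / 2) u +
      fun_scale (\<mu> * (a i + \<i> * a j) / 2) v"
    by (auto simp: fun_scale_def)
  then show "f \<in> cfun.span {u, v}"
    by (simp add: cfun.span_add cfun.span_scale cfun.span_base)
qed

text \<open>Each monomial is a product of linear forms in \<open>u\<close> and \<open>v\<close>, and
  multiplication by a linear form raises the degree of a binary form by one.\<close>

lemma homogeneous_part_coordinates:
  assumes "f \<in> homogeneous_part d"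
  obtains t where "\<And>a b. f (point a b) = (\<Sum>l\<le>d. t l * a ^ (d - l) * b ^ l)"
proof -
  define H :: "nat \<Rightarrow> (complex \<Rightarrow> complex \<Rightarrow> complex) \<Rightarrow> bool" where
    "H d g \<longleftrightarrow> (\<exists>t. \<forall>a b. g a b = (\<Sum>l\<le>d. t l * a ^ (d - l) * b ^ l))" for d g
  have H_mult: "H (Suc d) (\<lambda>a b. (p * a + q * b) * g a b)" if g: "H d g" for d g p q
  proof -
    obtain t where t: "\<And>a b. g a b = (\<Sum>l\<le>d. t l * a ^ (d - l) * b ^ l)"
      using g unfolding H_def by blast
    \<comment> \<open>Coefficients of the product; the guards supply zeros at the new top index and
      at the shifted index 0.\<close>
    define t' where "t' l = p * (if l \<le> d then t l else 0) + q * (if l = 0 then 0 else t (l - 1))" for l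
    have "(p * a + q * b) * g a b = (\<Sum>l\<le>Suc d. t' l * a ^ (Suc d - l) * b ^ l)" for a b
    proof -
      have "(\<Sum>l\<le>Suc d. (if l \<le> d then t l else 0) * a ^ (Suc d - l) * b ^ l) = a * g a b"
        by (simp add: t sum_distrib_left Suc_diff_le mult_ac)
      moreover have "(\<Sum>l\<le>Suc d. (if l = 0 then 0 else t (l - 1)) * a ^ (Suc d - l) * b ^ l) = b * g a b"
        unfolding sum.atMost_Suc_shift by (simp add: t sum_distrib_left mult_ac)
      ultimately have "(p * a + q * b) * g a b =
          p * (\<Sum>l\<le>Suc d. (if l \<le> d then t l else 0) * a ^ (Suc d - l) * b ^ l) +
          q * (\<Sum>l\<le>Suc d. (if l = 0 then 0 else t (l - 1)) * a ^ (Suc d - l) * b ^ l)"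
        by (simp only: distrib_right mult.assoc)
      also have "\<dots> = (\<Sum>l\<le>Suc d. t' l * a ^ (Suc d - l) * b ^ l)"
        unfolding sum_distrib_left sum.distrib[symmetric] t'_def
        by (intro sum.cong refl) (simp only: distrib_right mult.assoc)
      finally show ?thesis .
    qed
    then show ?thesis unfolding H_def by blast
  qed
  have H_power: "H (n + d) (\<lambda>a b. (p * a + q * b) ^ n * g a b)" if "H d g" for n d g p q
  proof (induction n)
    case (Suc n)
    from H_mult[OF this, of p q] show ?case by (simp add: mult.assoc)
  qed (use that in simp)
  have "H d (\<lambda>a b. f (point a b))"
    using assms unfolding homogeneous_part_def
  proof (induction rule: cfun.span_induct_alt)
    case base
    show ?case unfolding H_def by (rule exI[of _ "\<lambda>_. 0"]) simp
  next
    case (step k g f)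
    then obtain e where e: "g = monomial e" "e i + e j = d"
      by (auto simp: sum_UNIV)
    have "H 0 (\<lambda>a b. 1)"
      unfolding H_def by (rule exI[of _ "\<lambda>_. 1"]) simp
    from H_power[OF H_power[OF this, of "e j" "- (\<i> * cnj \<mu> / 2)" "\<i> * \<mu> / 2"], of "e i" "cnj \<mu> / 2" "\<mu> / 2"]
    have "H d (\<lambda>a b. (cnj \<mu> / 2 * a + \<mu> / 2 * b) ^ e i *
        (- (\<i> * cnj \<mu> / 2) * a + \<i> * \<mu> / 2 * b) ^ e j)"
      by (simp only: e(2) mult_1_right add_0_right)
    moreover have "g (point a b) = (cnj \<mu> / 2 * a + \<mu> / 2 * b) ^ e i *
        (- (\<i> * cnj \<mu> / 2) * a + \<i> * \<mu> / 2 * b) ^ e j" for a b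
    proof -
      have "g (point a b) = (point a b $ i) ^ e i * (point a b $ j) ^ e j"
        using i_neq_j unfolding e(1) monomial_def UNIV_eq by simp
      also have "point a b $ i = cnj \<mu> / 2 * a + \<mu> / 2 * b"
        by (simp add: point_nth add_divide_distrib)
      also have "point a b $ j = - (\<i> * cnj \<mu> / 2) * a + \<i> * \<mu> / 2 * b"
        by (simp add: point_nth algebra_simps diff_divide_distrib)
      finally show ?thesis .
    qed
    ultimately have "H d (\<lambda>a b. g (point a b))"
      by simp
    then obtain t where t: "\<And>a b. g (point a b) = (\<Sum>l\<le>d. t l * a ^ (d - l) * b ^ l)"
      unfolding H_def by blast
    obtain t' where t': "\<And>a b. f (point a b) = (\<Sum>l\<le>d. t' l * a ^ (d - l) * b ^ l)"
      using step.IH unfolding H_def by blast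
    have "(fun_scale k g + f) (point a b) = (\<Sum>l\<le>d. (k * t l + t' l) * a ^ (d - l) * b ^ l)" for a b
      by (simp add: fun_scale_def t t' sum_distrib_left sum.distrib distrib_right mult.assoc)
    then show ?case unfolding H_def by (intro exI[of _ "\<lambda>l. k * t l + t' l"]) blast
  qed
  then show ?thesis
    using that unfolding H_def by blast
qed

text \<open>
  Comparing the \<open>C\<close>-weights \<open>m + 1 - 2 l\<close> of the monomials \<open>u ^ (m + 1 - l) v ^ l\<close> with the
  weight of \<open>u\<close> leaves only \<open>l = 0\<close>, \<open>l = m\<close> and, for even \<open>m\<close>, \<open>l = m div 2\<close>.
\<close>
lemma equivariant_form:
  assumes f: "f \<in> homogeneous_part (m + 1)"
    and eq: "\<And>a b. f (point (\<omega> * a) (cnj \<omega> * b)) = \<omega> * f (point a b)"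
  shows "\<exists>\<alpha> \<beta> \<gamma>. (odd m \<longrightarrow> \<beta> = 0) \<and>
    (\<forall>a b. f (point a b) = \<alpha> * a ^ (m + 1) + \<beta> * a ^ (m div 2 + 1) * b ^ (m div 2) + \<gamma> * a * b ^ m)"
proof -
  obtain t where t: "\<And>a b. f (point a b) = (\<Sum>l\<le>m + 1. t l * a ^ (m + 1 - l) * b ^ l)"
    by (rule homogeneous_part_coordinates[OF f]) blast
  \<comment> \<open>Setting the first coordinate to 1 turns equivariance into a polynomial identity
    in \<open>b\<close>, so coefficients can be compared.\<close>
  have "(\<Sum>l\<le>m + 1. t l * (\<omega> ^ (m + 1 - l) * cnj \<omega> ^ l - \<omega>) * b ^ l) = 0" for b
  proof -
    have "(\<Sum>l\<le>m + 1. t l * (\<omega> ^ (m + 1 - l) * cnj \<omega> ^ l - \<omega>) * b ^ l) =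
        f (point (\<omega> * 1) (cnj \<omega> * b)) - \<omega> * f (point 1 b)"
      unfolding t sum_distrib_left sum_subtractf[symmetric]
      by (intro sum.cong refl) (simp add: algebra_simps power_mult_distrib)
    then show ?thesis by (simp only: eq) simp
  qed
  then have t_weight: "t l = 0 \<or> \<omega> ^ (m + 1 - l) * cnj \<omega> ^ l = \<omega>" if "l \<le> m + 1" for l
    using polyfun_eq_0[of "\<lambda>l. t l * (\<omega> ^ (m + 1 - l) * cnj \<omega> ^ l - \<omega>)" "m + 1"] that by auto
  have t_zero: "t l = 0" if l: "l \<le> m + 1" "l \<noteq> 0" "l \<noteq> m" "2 * l \<noteq> m" for l
  proof (rule ccontr)
    assume "t l \<noteq> 0"
    then have *: "\<omega> ^ (m + 1 - l) * cnj \<omega> ^ l = \<omega>"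
      using t_weight l(1) by blast
    have "\<omega> ^ (m + 1) = \<omega> ^ (m + 1 - l) * \<omega> ^ l"
      using l(1) by (simp flip: power_add)
    also have "\<dots> = \<omega> ^ (m + 1 - l) * (cnj \<omega> * \<omega>) ^ l * \<omega> ^ l"
      by (simp add: root_cnj[OF \<omega>_root])
    also have "\<dots> = (\<omega> ^ (m + 1 - l) * cnj \<omega> ^ l) * (\<omega> ^ l * \<omega> ^ l)"
      by (simp add: power_mult_distrib mult_ac)
    also have "\<dots> = \<omega> * \<omega> ^ (2 * l)"
      unfolding * by (simp only: mult_2[of l] power_add)
    finally have "\<omega> ^ (2 * l) = 1"
      using root_cnj(4)[OF \<omega>_root] by (simp add: power_add)
    then have "m dvd 2 * l"
      by (simp only: \<omega>_power_eq_1_iff)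
    then obtain s where s: "2 * l = m * s"
      by (elim dvdE)
    \<comment> \<open>From \<open>l \<le> m + 1\<close> and \<open>m \<ge> 3\<close>,
      \<open>2 * l\<close> is below \<open>3 * m\<close>. The remaining values 0, 1, 2 of
      \<open>s\<close> are the excluded indices.\<close>
    have "s < 3"
    proof (rule ccontr)
      assume "\<not> s < 3"
      then have "m * 3 \<le> m * s"
        by simp
      then show False
        using l(1) m_ge_3 s by linarith
    qed
    then have "s = 0 \<or> s = 1 \<or> s = 2" by linarith
    then show False
      using s l by auto
  qed
  show ?thesis
  proof (rule exI[of _ "t 0"], rule exI[of _ "t (m div 2)"], rule exI[of _ "t m"], intro conjI allI impI)
    show "t (m div 2) = 0" if "odd m"
      using that m_ge_3 by (intro t_zero) auto
    fix a b
    \<comment> \<open>For odd \<open>m\<close> the middle index stays in the sum with coefficient 0,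
      which keeps one formula for both parities.\<close>
    have "f (point a b) = (\<Sum>l\<in>{0, m div 2, m}. t l * a ^ (m + 1 - l) * b ^ l)"
      unfolding t
    proof (rule sum.mono_neutral_right)
      show "\<forall>l\<in>{..m + 1} - {0, m div 2, m}. t l * a ^ (m + 1 - l) * b ^ l = 0"
        using t_zero by fastforce
    qed auto
    also have "\<dots> = t 0 * a ^ (m + 1) + t (m div 2) * a ^ (m + 1 - m div 2) * b ^ (m div 2) + t m * a * b ^ m"
      using m_ge_3 by (subst sum.insert; auto)
    also have "t (m div 2) * a ^ (m + 1 - m div 2) = t (m div 2) * a ^ (m div 2 + 1)"
    proof (cases "even m")
      case True
      then have "m + 1 - m div 2 = m div 2 + 1"
        by presburger
      then show ?thesis by simp
    next
      case False
      then have "t (m div 2) = 0"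
        using m_ge_3 by (intro t_zero) auto
      then show ?thesis by simp
    qed
    finally show "f (point a b) = t 0 * a ^ (m + 1) + t (m div 2) * a ^ (m div 2 + 1) * b ^ (m div 2) + t m * a * b ^ m" .
  qed
qed

text \<open>Two group elements suffice: \<open>c\<close> determines the shape of
  \<open>\<phi> u\<close> by \<open>equivariant_form\<close>, and \<open>mirror 1\<close> exchanges
  \<open>u\<close> and \<open>v\<close>, so \<open>\<phi> v\<close> is the same form with swapped
  arguments.\<close>

lemma V_Theta_solutions:
  assumes x: "is_dual_basis x" and \<theta>: "admissible_hsop W m x \<theta>"
  obtains \<alpha> \<beta> \<gamma> where "dihedral_hsop m (m div 2) \<alpha> \<beta> \<gamma>"
    and "V_Theta x \<theta> = (\<lambda>(a, b). point a b) ` dihedral_hsop.solutions m (m div 2) \<alpha> \<beta> \<gamma>"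
proof -
  have dual: "u \<in> dual_space" "v \<in> dual_space"
    unfolding span_u_v[symmetric] by (simp_all add: cfun.span_base)
  obtain \<phi> where hom: "\<And>f. f \<in> dual_space \<Longrightarrow> \<phi> f \<in> homogeneous_part (m + 1)"
    and eq: "\<And>w f. w \<in> W \<Longrightarrow> f \<in> dual_space \<Longrightarrow> \<phi> (fun_action w f) = fun_action w (\<phi> f)"
    and zero: "\<And>z. (\<And>f. f \<in> {u, v} \<Longrightarrow> \<phi> f z = 0) \<Longrightarrow> z = 0"
    and V: "V_Theta x \<theta> = {z. \<forall>f\<in>{u, v}. \<phi> f z = f z}"
    and lin: "\<And>f g a b. \<phi> (\<lambda>z. a * f z + b * g z) = (\<lambda>z. a * \<phi> f z + b * \<phi> g z)"
    by (rule admissible_hsopE[OF x \<theta> span_u_v]) blast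
  have inv: "inv\<^bsub>orthogonal_group\<^esub> w = transpose w" if "w \<in> W" for w
    using inv_orthogonal_group subgroup_orthogonal_groupD(1)[OF subgroup that] by blast
  have "\<phi> u (point (\<omega> * a) (cnj \<omega> * b)) = \<omega> * \<phi> u (point a b)" for a b
  proof -
    \<comment> \<open>Functions are acted on through the inverse of \<open>c\<close>, which scales
      \<open>u\<close> by \<open>\<omega>\<close>.\<close>
    have act: "fun_action c f = (\<lambda>z. f (point (\<omega> * u z) (cnj \<omega> * v z)))" for f
    proof
      fix z
      have "complexify (transpose c) *v point (u z) (v z) = point (\<omega> * u z) (cnj \<omega> * v z)"
        unfolding c_eq transpose_rotation complex_cnj_cnj by (rule rotation_point)
      then show "fun_action c f z = f (point (\<omega> * u z) (cnj \<omega> * v z))"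
        by (simp add: fun_action_def inv[OF c_in_W])
    qed
    have "\<phi> (fun_action c u) = (\<lambda>z. \<omega> * \<phi> u z)"
      using lin[of \<omega> u 0 u] by (simp add: act)
    then show ?thesis
      using fun_cong[OF eq[OF c_in_W dual(1)], of "point a b"] by (simp add: act)
  qed
  from equivariant_form[OF hom[OF dual(1)] this]
  obtain \<alpha> \<beta> \<gamma> where odd: "odd m \<longrightarrow> \<beta> = 0"
    and \<phi>u: "\<And>a b. \<phi> u (point a b) = \<alpha> * a ^ (m + 1) + \<beta> * a ^ (m div 2 + 1) * b ^ (m div 2) + \<gamma> * a * b ^ m"
    by blast
  interpret E: dihedral_equations m "m div 2" \<alpha> \<beta> \<gamma>
    by unfold_locales (use m_pos odd in auto)
  have \<phi>u': "\<phi> u (point a b) = E.R a b" for a b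
    by (simp add: E.R_def \<phi>u)
  have \<phi>v: "\<phi> v (point a b) = E.R b a" for a b
  proof -
    have act: "fun_action (mirror 1) f = (\<lambda>z. f (point (v z) (u z)))" for f
    proof
      fix z
      have "transpose (mirror 1) = mirror 1"
        by (simp add: mirror_def transpose_reflection)
      moreover have "complexify (mirror 1) *v point (u z) (v z) = point (v z) (u z)"
        by (simp add: mirror_point del: point_u_v)
      ultimately show "fun_action (mirror 1) f z = f (point (v z) (u z))"
        by (simp add: fun_action_def inv[OF root_in_W(2)])
    qed
    have "fun_action (mirror 1) u = v"
      by (simp add: act)
    then have "\<phi> v = fun_action (mirror 1) (\<phi> u)"
      using eq[OF root_in_W(2)[of 1] dual(1)] by simp
    then show ?thesis
      by (simp add: act \<phi>u')
  qed
  have hsop: "dihedral_hsop m (m div 2) \<alpha> \<beta> \<gamma>"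
  proof unfold_locales
    fix a b assume "E.R a b = 0" "E.R b a = 0"
    then have "point a b = 0"
      by (intro zero) (auto simp: \<phi>u' \<phi>v)
    then show "a = 0 \<and> b = 0"
      by (simp flip: point_0 add: point_eq_iff)
  qed
  have "V_Theta x \<theta> = (\<lambda>(a, b). point a b) ` dihedral_hsop.solutions m (m div 2) \<alpha> \<beta> \<gamma>"
  proof (intro equalityI subsetI)
    fix z assume "z \<in> V_Theta x \<theta>"
    then have "(u z, v z) \<in> dihedral_hsop.solutions m (m div 2) \<alpha> \<beta> \<gamma>"
      using \<phi>u'[of "u z" "v z"] \<phi>v[of "u z" "v z"]
      by (simp add: V dihedral_hsop.solutions_def[OF hsop])
    then show "z \<in> (\<lambda>(a, b). point a b) ` dihedral_hsop.solutions m (m div 2) \<alpha> \<beta> \<gamma>"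
      by (intro image_eqI[of _ _ "(u z, v z)"]) simp_all
  next
    fix z assume "z \<in> (\<lambda>(a, b). point a b) ` dihedral_hsop.solutions m (m div 2) \<alpha> \<beta> \<gamma>"
    then show "z \<in> V_Theta x \<theta>"
      by (auto simp: V \<phi>u' \<phi>v dihedral_hsop.solutions_def[OF hsop])
  qed
  with hsop show ?thesis by (rule that)
qed

end

section \<open>Assembly of rank two and the case distinction on the rank\<close>

lemma (in plane) rank_two:
  fixes W :: "(real^'n^'n) set" and x \<theta> :: "'n \<Rightarrow> complex^'n \<Rightarrow> complex"
  assumes W: "subgroup W orthogonal_group" "finite W" "acts_irreducibly W"
    and simple: "simple_system W [a1, a2]"
    and orientation: "Im (to_complex a2 * cnj (to_complex a1)) < 0"
    and c: "c = coxeter_element [a1, a2]"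
    and h: "h = group.ord orthogonal_group c"
    and x: "is_dual_basis x" and \<theta>: "admissible_hsop W h x \<theta>"
  shows "card (V_Theta x \<theta>) = (h + 1) ^ CARD('n) \<and>
         (\<exists>F. equivariant_bijection W c h (V_Theta x \<theta>) F)"
proof -
  from dihedralI[OF W simple orientation] obtain m \<mu> where "dihedral i j W m \<mu> c"
    unfolding c by blast
  then interpret dihedral i j W m \<mu> c .
  have h_eq: "h = m"
    by (simp add: h ord_c)
  obtain \<alpha> \<beta> \<gamma> where hsop: "dihedral_hsop m (m div 2) \<alpha> \<beta> \<gamma>"
    and V: "V_Theta x \<theta> = (\<lambda>(a, b). point a b) ` dihedral_hsop.solutions m (m div 2) \<alpha> \<beta> \<gamma>"
    using V_Theta_solutions[OF x \<theta>[unfolded h_eq]] .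
  have "inj_on (\<lambda>(a, b). point a b) S" for S
    by (auto simp: inj_on_def point_eq_iff)
  then have "card (V_Theta x \<theta>) = (m + 1) ^ 2"
    unfolding V by (simp add: card_image dihedral_hsop.card_solutions[OF hsop])
  moreover have "CARD('n) = 2"
    using i_neq_j by (simp add: UNIV_eq)
  ultimately show ?thesis
    using equivariant_bijection_solutions[OF hsop] V h_eq by simp
qed

theorem corollary2p14:
  fixes W :: "(real^'n^'n) set"
    and simples :: "(real^'n) list"
    and c :: "real^'n^'n"
    and h :: nat
    and x \<theta> :: "'n \<Rightarrow> complex^'n \<Rightarrow> complex"
  assumes "irreducible_reflection_group W"
    and "CARD('n) \<le> 2"
    and "simple_system W simples"
    and "c = coxeter_element simples"
    and "h = group.ord orthogonal_group c"
    and "is_dual_basis x"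
    and "admissible_hsop W h x \<theta>"
  shows "card (V_Theta x \<theta>) = (h + 1) ^ CARD('n) \<and>
         (\<exists>F. equivariant_bijection W c h (V_Theta x \<theta>) F)"
proof -
  have W: "subgroup W orthogonal_group" "finite W" "acts_irreducibly W"
    using assms(1) by (auto simp: irreducible_reflection_group_def)
  have "CARD('n) \<noteq> 0" by simp
  then consider "CARD('n) = 1" | "CARD('n) = 2"
    using assms(2) by linarith
  then show ?thesis
  proof cases
    case 1
    from rank_one[OF W(1) this assms(3-7)] show ?thesis .
  next
    case 2
    then obtain i j :: 'n where ij: "UNIV = {i, j}" "i \<noteq> j"
      by (auto simp: card_2_iff)
    \<comment> \<open>Exchanging the coordinates changes the sign of \<open>\<epsilon>\<close>, so
      one of the two interpretations meets the orientation hypothesis whatever the order of the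
      simple roots.\<close>
    interpret P: plane i j
      using ij by unfold_locales auto
    interpret Q: plane j i
      using ij by unfold_locales auto
    obtain a1 a2 where as: "simples = [a1, a2]"
      using simple_system_length[OF assms(3)] 2 by (auto simp: length_Suc_conv numeral_2_eq_2)
    define \<epsilon> where "\<epsilon> = Im (P.to_complex a2 * cnj (P.to_complex a1))"
    have \<epsilon>': "Im (Q.to_complex a2 * cnj (Q.to_complex a1)) = - \<epsilon>"
      by (simp add: \<epsilon>_def P.to_complex_def Q.to_complex_def)
    \<comment> \<open>Otherwise the quotient of the two roots would be real and the simple roots
      linearly dependent.\<close>
    have "\<epsilon> \<noteq> 0"
    proof
      assume "\<epsilon> = 0"
      have indep: "a1 \<noteq> a2" "independent {a1, a2}"
        using assms(3) by (auto simp: as simple_system_def)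
      have "norm a1 = 1"
        using assms(3) by (auto simp: as simple_system_def unit_roots_def)
      then have "P.to_complex a1 * cnj (P.to_complex a1) = 1"
        using P.norm_to_complex[of a1] by (simp add: complex_norm_square[symmetric])
      moreover define k where "k = Re (P.to_complex a2 * cnj (P.to_complex a1))"
      have "P.to_complex a2 * cnj (P.to_complex a1) = of_real k"
        using \<open>\<epsilon> = 0\<close> by (simp add: complex_eq_iff k_def \<epsilon>_def)
      moreover have "P.to_complex a2 * (P.to_complex a1 * cnj (P.to_complex a1)) =
          P.to_complex a2 * cnj (P.to_complex a1) * P.to_complex a1"
        by (simp only: mult_ac)
      ultimately have "P.to_complex a2 = of_real k * P.to_complex a1"
        by simp
      then have "a2 = k *\<^sub>R a1"
        by (metis P.to_complex_linear(2) P.to_complex_eq_iff)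
      then have "a2 \<in> span {a1}"
        by (simp add: span_base span_scale)
      then show False
        using indep independent_insert[of a2 "{a1}"] by (simp add: insert_commute)
    qed
    then consider "\<epsilon> < 0" | "- \<epsilon> < 0" by linarith
    then show ?thesis
    proof cases
      case 1
      then show ?thesis
        using P.rank_two[OF W assms(3)[unfolded as] _ assms(4)[unfolded as] assms(5-7)] by (simp add: \<epsilon>_def)
    next
      case 2
      then show ?thesis
        using Q.rank_two[OF W assms(3)[unfolded as] _ assms(4)[unfolded as] assms(5-7)] \<epsilon>' by simp
    qed
  qed
qed

end
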